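(* There exists a constant $c>0$ such that if $G=(V,E)$ excludes a $K_h$-minor at depth $L$ and $n=|V|$, then any unit $K_n$-flow $F$ in $G$ has $$\mathsf{con}_2(F)\geq c\min\left(\frac{n^2}{h\sqrt{\log h}},\ n^{3/2}L\right)$$ for $n\geq c\,h\sqrt{\log h}$.
   Context: $H$ is a minor of $G$ at depth $L$ if there exist pairwise disjoint sets $\{A_v\}_{v\in V(H)}$ of vertices of $G$, each inducing a connected subgraph of $G$, with $\max_{i,j\in A_v}\mathsf{dist}_G(i,j)\leq L$ for every $v$ (where $\mathsf{dist}_G$ is the shortest-path distance in $G$), and with an edge of $G$ between $A_u$ and $A_v$ whenever $(u,v)\in E(H)$. $G$ excludes a $K_h$-minor at depth $L$ if $K_h$ is not a minor of $G$ at depth $L$. For $u,v\in V$, $\mathcal P_{uv}$ is the set of paths in $G$ between $u$ and $v$. A flow is a map $F$ from the set of all paths to $\mathbb R_+$; its vertex congestion at $v$ is $C_F(v)=\sum_{p\ni v}F(p)$ and $\mathsf{con}_2(F)=\left(\sum_{v\in V}C_F(v)^2\right)^{1/2}$. A unit $K_n$-flow is a flow with $\sum_{p\in\mathcal P_{uv}}F(p)=1$ for every pair of distinct $u,v\in V$.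
   Formalization: The formal statement assumes n ≥ 2: for a single-vertex graph the zero flow is a unit flow with con_2 = 0, while the stated lower bound is positive (for example h = 2, L = 1, c ≤ 0.6), and constants c > 0.6 are too large for the bound to hold. *)

theory Defs
  imports Complex_Main "HOL-Library.Disjoint_Sets" "Graph_Theory.Graph_Theory"
begin

text \<open>
  A finite simple undirected graph is a \<^locale>\<open>graph\<close> of the library: a finite symmetric digraph
  without loops and parallel arcs.
\<close>

abbreviation dist_in :: "('a, 'b) pre_digraph \<Rightarrow> 'a \<Rightarrow> 'a \<Rightarrow> ereal" where
  "dist_in G u v \<equiv> wf_digraph.\<mu> G (\<lambda>_. 1) u v"

text \<open>
  The distance bound is on the distance in the whole graph \<open>G\<close>, not in the subgraph induced by a
  branch set. Branch sets are nonempty because \<^const>\<open>Digraph_Component.connected\<close> excludes the empty graph.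
\<close>

definition minor_at_depth ::
    "('c, 'd) pre_digraph \<Rightarrow> nat \<Rightarrow> ('a, 'b) pre_digraph \<Rightarrow> bool" where
  "minor_at_depth H L G \<longleftrightarrow>
    (\<exists>A :: 'c \<Rightarrow> 'a set.
       disjoint_family_on A (verts H) \<and>
       (\<forall>v \<in> verts H. A v \<subseteq> verts G \<and> Digraph_Component.connected (G \<restriction> A v) \<and>
          (\<forall>i \<in> A v. \<forall>j \<in> A v. dist_in G i j \<le> ereal (real L))) \<and>
       (\<forall>u v. u \<rightarrow>\<^bsub>H\<^esub> v \<longrightarrow> (\<exists>x \<in> A u. \<exists>y \<in> A v. x \<rightarrow>\<^bsub>G\<^esub> y)))"

definition excludes_complete_minor :: "nat \<Rightarrow> nat \<Rightarrow> ('a, 'b) pre_digraph \<Rightarrow> bool" where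
  "excludes_complete_minor h L G \<longleftrightarrow>
    \<not> (\<exists>K :: (nat, nat \<times> nat) pre_digraph. complete_digraph h K \<and> minor_at_depth K L G)"

text \<open>
  An undirected path with distinct ends is traversed by two vertex lists, \<open>p\<close> and \<open>rev p\<close>. Both
  belong to \<open>paths_between G u v = paths_between G v u\<close>, and the flow along the undirected path is
  \<open>F p + F (rev p)\<close>. The sums below therefore agree with the sums over undirected paths, and the
  unit demand is routed once for each unordered pair.
\<close>

definition paths_between :: "('a, 'b) pre_digraph \<Rightarrow> 'a \<Rightarrow> 'a \<Rightarrow> 'a list set" where
  "paths_between G u v = {p. vpath p G \<and> {hd p, last p} = {u, v}}"

definition is_flow :: "('a, 'b) pre_digraph \<Rightarrow> ('a list \<Rightarrow> real) \<Rightarrow> bool" where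
  "is_flow G F \<longleftrightarrow> (\<forall>p. vpath p G \<longrightarrow> 0 \<le> F p)"

definition congestion :: "('a, 'b) pre_digraph \<Rightarrow> ('a list \<Rightarrow> real) \<Rightarrow> 'a \<Rightarrow> real" where
  "congestion G F v = (\<Sum>p | vpath p G \<and> v \<in> set p. F p)"

definition con2 :: "('a, 'b) pre_digraph \<Rightarrow> ('a list \<Rightarrow> real) \<Rightarrow> real" where
  "con2 G F = sqrt (\<Sum>v \<in> verts G. (congestion G F v)\<^sup>2)"

definition unit_complete_flow :: "('a, 'b) pre_digraph \<Rightarrow> ('a list \<Rightarrow> real) \<Rightarrow> bool" where
  "unit_complete_flow G F \<longleftrightarrow> is_flow G F \<and>
    (\<forall>u \<in> verts G. \<forall>v \<in> verts G. u \<noteq> v \<longrightarrow> (\<Sum>p \<in> paths_between G u v. F p) = 1)"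

end

theory Submission
  imports Defs "HOL-Library.FuncSet" "HOL-Analysis.Convex" "HOL-Analysis.Harmonic_Numbers"
begin

text \<open>
  The flow is first replaced by a family of trees, one for each source \<open>w\<close>, whose squared loads are
  within a constant factor of those of the flow: a family that minimises the total squared load is
  locally optimal, and the flow out of \<open>w\<close> costs at least as much as a shortest-path tree for any
  vertex weights. If \<open>con2\<close> is small, then most tree paths are short and random pairs of them rarely
  meet. Sampling two lists of \<open>k\<close> vertices, \<open>k\<close> of order \<open>h * sqrt (ln h)\<close>, and discarding the long
  or crossing paths leaves a bipartite graph on \<open>k + k\<close> indices that misses only a small proportion of the pairs.

  In such a graph one builds \<open>h\<close> disjoint double stars of size of order \<open>sqrt (ln h)\<close> greedily: each
  star leaves only an exponentially small proportion of the left side undominated, so the next star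
  can be chosen to touch all earlier ones. Stars rather than arbitrary connected sets keep the
  diameter of a branch set within six path lengths. Paths with a common endpoint may still meet;
  since the paths out of \<open>w\<close> form a tree, each path can be cut into a part owned by its start and a part
  owned by its end in such a way that all parts of different owners are disjoint.
\<close>

section \<open>Dense bipartite graphs\<close>

lemma greedy_hitting:
  fixes hits :: "'i \<Rightarrow> 'v \<Rightarrow> bool"
  assumes "finite I" "finite N" "N \<noteq> {}"
    and miss: "\<And>i. i \<in> I \<Longrightarrow> b * card {v \<in> N. \<not> hits i v} \<le> card N"
  shows "\<exists>X \<subseteq> N. card X \<le> s \<and> b ^ s * card {i \<in> I. \<forall>v \<in> X. \<not> hits i v} \<le> card I"
proof (induction s)
  case 0
  show ?case by (rule exI[of _ "{}"]) auto
next
  case (Suc s)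
  then obtain X where X: "X \<subseteq> N" "card X \<le> s"
    "b ^ s * card {i \<in> I. \<forall>v \<in> X. \<not> hits i v} \<le> card I" by auto
  define J where "J = {i \<in> I. \<forall>v \<in> X. \<not> hits i v}"
  have J: "finite J" "J \<subseteq> I" using assms(1) by (auto simp: J_def)
  have "(\<Sum>v\<in>N. card {i \<in> J. \<not> hits i v}) = (\<Sum>i\<in>J. card {v \<in> N. \<not> hits i v})"
    by (rule sum_multicount_gen) (use assms J in auto)
  then have "(\<Sum>v\<in>N. b * card {i \<in> J. \<not> hits i v}) = (\<Sum>i\<in>J. b * card {v \<in> N. \<not> hits i v})"
    by (simp flip: sum_distrib_left)
  also have "\<dots> \<le> card J * card N"
    using sum_bounded_above[of J "\<lambda>i. b * card {v \<in> N. \<not> hits i v}" "card N"] miss J by auto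
  finally have le: "(\<Sum>v\<in>N. b * card {i \<in> J. \<not> hits i v}) \<le> card J * card N" .
  have "\<exists>v\<in>N. b * card {i \<in> J. \<not> hits i v} \<le> card J"
  proof (rule ccontr)
    assume "\<not> ?thesis"
    then have "(\<Sum>v\<in>N. card J) < (\<Sum>v\<in>N. b * card {i \<in> J. \<not> hits i v})"
      using assms by (intro sum_strict_mono) auto
    with le show False by (simp add: mult.commute)
  qed
  then obtain v where v: "v \<in> N" "b * card {i \<in> J. \<not> hits i v} \<le> card J" by auto
  have eq: "{i \<in> I. \<forall>x \<in> insert v X. \<not> hits i x} = {i \<in> J. \<not> hits i v}"
    by (auto simp: J_def)
  have "b ^ Suc s * card {i \<in> J. \<not> hits i v} \<le> b ^ s * card J"
    using mult_left_mono[OF v(2), of "b ^ s"] by (simp add: algebra_simps)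
  also have "\<dots> \<le> card I" using X(3) by (simp add: J_def)
  finally have "b ^ Suc s * card {i \<in> I. \<forall>x \<in> insert v X. \<not> hits i x} \<le> card I"
    by (simp only: eq)
  moreover have "card (insert v X) \<le> Suc s"
    using X(2) card_insert_le_m1[of "Suc s" X v] by simp
  ultimately show ?case using X(1) v(1) by (intro exI[of _ "insert v X"]) auto
qed

lemma few_poor_rows:
  fixes E :: "'x \<Rightarrow> 'y \<Rightarrow> bool" and k m q :: nat
  assumes "finite A" "finite B" "k > 0"
    and missing: "m * q * card {(l, r) \<in> A \<times> B. \<not> E l r} \<le> k * k"
  shows "m * card {l \<in> A. k < q * card {r \<in> B. \<not> E l r}} \<le> k"
proof -
  define P where "P = {l \<in> A. k < q * card {r \<in> B. \<not> E l r}}"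
  have fP: "finite P" using assms by (simp add: P_def)
  have "card P * k \<le> (\<Sum>l\<in>P. q * card {r \<in> B. \<not> E l r})"
    using sum_bounded_below[of P k "\<lambda>l. q * card {r \<in> B. \<not> E l r}"]
    by (auto simp: P_def less_imp_le)
  also have "\<dots> = q * card (Sigma P (\<lambda>l. {r \<in> B. \<not> E l r}))"
    using fP assms by (simp add: card_SigmaI sum_distrib_left)
  also have "\<dots> \<le> q * card {(l, r) \<in> A \<times> B. \<not> E l r}"
    using assms by (intro mult_left_mono card_mono)
      (auto simp: P_def intro: finite_subset[of _ "A \<times> B"])
  finally have "m * (card P * k) \<le> m * (q * card {(l, r) \<in> A \<times> B. \<not> E l r})"
    by (rule mult_left_mono) simp
  also note missing[unfolded mult.assoc]
  finally have "m * card P * k \<le> k * k" by (simp add: mult.assoc)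
  with \<open>k > 0\<close> show ?thesis by (simp add: P_def)
qed

lemma dense_bipartite_branch_sets:
  fixes E :: "nat \<Rightarrow> nat \<Rightarrow> bool" and h k s :: nat
  assumes h: "h \<ge> 1" "h < 4 ^ (s * s)" and s: "s \<ge> 1" and k: "k = 16 * (h * (s + 1))"
    and missing: "128 * card {(l, r) \<in> {..<k} \<times> {..<k}. \<not> E l r} \<le> k * k"
  obtains L R X Y c d where "L \<subseteq> {..<k}" "R \<subseteq> {..<k}"
    "\<And>l r. l \<in> L \<Longrightarrow> \<exists>r' \<in> R. r' \<noteq> r \<and> E l r'" "\<And>l r. r \<in> R \<Longrightarrow> \<exists>l' \<in> L. l' \<noteq> l \<and> E l' r"
    "\<And>i. i < h \<Longrightarrow> X i \<subseteq> L \<and> Y i \<subseteq> R \<and> c i \<in> X i \<and> d i \<in> Y i"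
    "\<And>i x. i < h \<Longrightarrow> x \<in> X i \<Longrightarrow> E x (d i)" "\<And>i y. i < h \<Longrightarrow> y \<in> Y i \<Longrightarrow> E (c i) y"
    "\<And>i j. i < j \<Longrightarrow> j < h \<Longrightarrow> X i \<inter> X j = {} \<and> Y i \<inter> Y j = {} \<and> (\<exists>x \<in> X j. \<exists>y \<in> Y i. E x y)"
proof -
  have "1 * 2 \<le> h * (s + 1)" using h s by (intro mult_mono) auto
  then have kpos: "k \<ge> 32" by (simp add: k)
  have ne: "finite A \<and> A \<noteq> {}" if "3 * k \<le> 4 * card A" for A :: "nat set"
    using that kpos card_gt_0_iff[of A] by simp
  define L where "L = {l \<in> {..<k}. 8 * card {r \<in> {..<k}. \<not> E l r} \<le> k}"
  define R where "R = {r \<in> {..<k}. 8 * card {l \<in> {..<k}. \<not> E l r} \<le> k}"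
  have fin[simp]: "finite L" "finite R" by (auto simp: L_def R_def)
  have sub: "L \<subseteq> {..<k}" "R \<subseteq> {..<k}" by (auto simp: L_def R_def)
  have "16 * card {l \<in> {..<k}. k < 8 * card {r \<in> {..<k}. \<not> E l r}} \<le> k"
    using missing kpos by (intro few_poor_rows) auto
  moreover have "{l \<in> {..<k}. k < 8 * card {r \<in> {..<k}. \<not> E l r}} = {..<k} - L"
    by (auto simp: L_def)
  ultimately have cL: "15 * k \<le> 16 * card L" using card_Diff_subset[of L "{..<k}"] sub by simp
  have "bij_betw prod.swap {(l, r) \<in> {..<k} \<times> {..<k}. \<not> E l r} {(r, l) \<in> {..<k} \<times> {..<k}. \<not> E l r}"
    by (rule bij_betwI[where g = prod.swap]) auto
  then have "card {(r, l) \<in> {..<k} \<times> {..<k}. \<not> E l r} = card {(l, r) \<in> {..<k} \<times> {..<k}. \<not> E l r}"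
    by (simp add: bij_betw_same_card)
  then have "16 * card {r \<in> {..<k}. k < 8 * card {l \<in> {..<k}. \<not> E l r}} \<le> k"
    using missing kpos by (intro few_poor_rows) auto
  moreover have "{r \<in> {..<k}. k < 8 * card {l \<in> {..<k}. \<not> E l r}} = {..<k} - R"
    by (auto simp: R_def)
  ultimately have cR: "15 * k \<le> 16 * card R" using card_Diff_subset[of R "{..<k}"] sub by simp
  have large: "3 * k \<le> 4 * card {v \<in> S - U. Q v}"
    if "15 * k \<le> 16 * card S" "finite S" "S \<subseteq> {..<k}" "16 * card U \<le> k" "finite U"
      "8 * card {v \<in> {..<k}. \<not> Q v} \<le> k" for S U :: "nat set" and Q
  proof -
    have "S \<subseteq> {v \<in> S - U. Q v} \<union> U \<union> {v \<in> {..<k}. \<not> Q v}" using that by auto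
    then have "card S \<le> card ({v \<in> S - U. Q v} \<union> U \<union> {v \<in> {..<k}. \<not> Q v})"
      using that by (intro card_mono) auto
    also have "\<dots> \<le> card {v \<in> S - U. Q v} + card U + card {v \<in> {..<k}. \<not> Q v}"
      by (meson card_Un_le add_le_mono1 le_trans)
    finally show ?thesis using that by linarith
  qed
  have Lmiss: "8 * card {r \<in> {..<k}. \<not> E l r} \<le> k" if "l \<in> L" for l using that by (auto simp: L_def)
  have Rmiss: "8 * card {l \<in> {..<k}. \<not> E l r} \<le> k" if "r \<in> R" for r using that by (auto simp: R_def)
  have deg: "\<exists>v' \<in> S. v' \<noteq> v \<and> Q v'"
    if "15 * k \<le> 16 * card S" "finite S" "S \<subseteq> {..<k}" "8 * card {v \<in> {..<k}. \<not> Q v} \<le> k"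
    for S and v :: nat and Q
  proof -
    have "3 * k \<le> 4 * card {v' \<in> S - {v}. Q v'}" using that kpos by (intro large) auto
    from ne[OF this] show ?thesis by blast
  qed
  define good where "good m X Y c d \<longleftrightarrow>
    (\<forall>i<m. X i \<subseteq> L \<and> Y i \<subseteq> R \<and> c i \<in> X i \<and> d i \<in> Y i \<and> (\<forall>x\<in>X i. E x (d i)) \<and> (\<forall>y\<in>Y i. E (c i) y)
      \<and> card (X i) \<le> s + 1 \<and> card (Y i) \<le> s + 1
      \<and> 6 ^ s * card {l \<in> L. \<forall>y\<in>Y i. \<not> E l y} \<le> card L) \<and>
    (\<forall>j<m. \<forall>i<j. X i \<inter> X j = {} \<and> Y i \<inter> Y j = {} \<and> (\<exists>x \<in> X j. \<exists>y \<in> Y i. E x y))"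
    for m and X Y :: "nat \<Rightarrow> nat set" and c d
  have "\<exists>X Y c d. good m X Y c d" if "m \<le> h" for m using that
  proof (induction m)
    case 0
    then show ?case by (auto simp: good_def)
  next
    case (Suc m)
    then obtain X Y c d where g: "good m X Y c d" by auto
    have used: "16 * card (\<Union>i<m. Z i) \<le> k" if "\<And>i. i < m \<Longrightarrow> card (Z i) \<le> s + 1" for Z :: "nat \<Rightarrow> nat set"
    proof -
      have "card (\<Union>i<m. Z i) \<le> (\<Sum>i<m. card (Z i))" by (rule card_UN_le) simp
      also have "\<dots> \<le> m * (s + 1)" using sum_bounded_above[of "{..<m}" "\<lambda>i. card (Z i)" "s + 1"] that by auto
      also have "\<dots> \<le> h * (s + 1)" using Suc.prems by (intro mult_right_mono) auto
      finally show ?thesis by (simp add: k)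
    qed
    define UX where "UX = (\<Union>i<m. X i)"
    define UY where "UY = (\<Union>i<m. Y i)"
    have "UX \<subseteq> L" "UY \<subseteq> R" using g by (auto simp: good_def UX_def UY_def)
    then have fU: "finite UX" "finite UY" by (auto intro: finite_subset)
    have U: "16 * card UX \<le> k" "16 * card UY \<le> k"
      using g unfolding UX_def UY_def good_def by (auto intro!: used)
    have "3 * k \<le> 4 * card {v \<in> R - UY. True}" using cR U sub fU kpos by (intro large) auto
    from ne[OF this] obtain d' where d': "d' \<in> R" "d' \<notin> UY" by auto
    define NX where "NX = {l \<in> L - UX. E l d'}"
    have NX: "3 * k \<le> 4 * card NX" unfolding NX_def
      using cL U sub fU Rmiss[OF d'(1)] by (intro large) auto
    have fNX: "finite NX" "NX \<noteq> {}" using ne[OF NX] by auto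
    have "4 ^ s * card {l \<in> NX. \<not> (\<exists>y\<in>Y i. E l y)} \<le> card NX" if "i < m" for i
    proof -
      have 46: "3 * 4 ^ s \<le> (2 * 6 ^ s :: nat)" using s
        by (induction s rule: dec_induct) auto
      have le: "card {l \<in> NX. \<not> (\<exists>y\<in>Y i. E l y)} \<le> card {l \<in> L. \<forall>y\<in>Y i. \<not> E l y}" (is "?a \<le> ?b")
        by (intro card_mono) (auto simp: NX_def)
      have "3 * 4 ^ s * ?a \<le> 2 * 6 ^ s * ?b" by (rule mult_mono[OF 46 le]) auto
      also have "\<dots> \<le> 2 * card L" using g that by (auto simp: good_def)
      also have "\<dots> \<le> 2 * k" using card_mono[OF _ sub(1)] by simp
      finally show ?thesis using NX by linarith
    qed
    then obtain X' where X': "X' \<subseteq> NX" "card X' \<le> s"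
      "(4 ^ s) ^ s * card {i \<in> {..<m}. \<forall>l\<in>X'. \<not> (\<exists>y\<in>Y i. E l y)} \<le> card {..<m}"
      using greedy_hitting[of "{..<m}" NX "4 ^ s" "\<lambda>i l. \<exists>y\<in>Y i. E l y" s] fNX by auto
    have hit: "\<exists>l\<in>X'. \<exists>y\<in>Y i. E l y" if "i < m" for i
    proof (rule ccontr)
      assume "\<not> ?thesis"
      then have "i \<in> {i \<in> {..<m}. \<forall>l\<in>X'. \<not> (\<exists>y\<in>Y i. E l y)}" using that by auto
      then have "card {i \<in> {..<m}. \<forall>l\<in>X'. \<not> (\<exists>y\<in>Y i. E l y)} > 0"
        by (subst card_gt_0_iff) auto
      then have "(4 ^ s) ^ s * 1 \<le> (4 ^ s) ^ s * card {i \<in> {..<m}. \<forall>l\<in>X'. \<not> (\<exists>y\<in>Y i. E l y)}"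
        by (intro mult_left_mono) auto
      with X'(3) have "4 ^ (s * s) \<le> m" by (simp only: power_mult card_lessThan)
      with h Suc.prems show False by simp
    qed
    obtain c' where c': "c' \<in> NX" using fNX by auto
    define NY where "NY = {r \<in> R - UY. E c' r}"
    have c'L: "c' \<in> L" "c' \<notin> UX" "E c' d'" using c' by (auto simp: NX_def)
    have NY: "3 * k \<le> 4 * card NY" unfolding NY_def
      using cR U sub fU Lmiss[OF c'L(1)] by (intro large) auto
    have fNY: "finite NY" "NY \<noteq> {}" using ne[OF NY] by auto
    have "6 * card {r \<in> NY. \<not> E l r} \<le> card NY" if "l \<in> L" for l
    proof -
      have "card {r \<in> NY. \<not> E l r} \<le> card {r \<in> {..<k}. \<not> E l r}"
        using sub by (intro card_mono) (auto simp: NY_def)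
      then show ?thesis using Lmiss[OF that] NY by linarith
    qed
    then obtain Y' where Y': "Y' \<subseteq> NY" "card Y' \<le> s"
      "6 ^ s * card {l \<in> L. \<forall>r\<in>Y'. \<not> E l r} \<le> card L"
      using greedy_hitting[of L NY 6 E s] fNY by auto
    define X2 where "X2 = X(m := insert c' X')"
    define Y2 where "Y2 = Y(m := insert d' Y')"
    have cards: "card (insert c' X') \<le> s + 1" "card (insert d' Y') \<le> s + 1"
      using X'(2) Y'(2) card_insert_le_m1[of "s + 1"] by auto
    have "6 ^ s * card {l \<in> L. \<forall>r\<in>insert d' Y'. \<not> E l r} \<le> 6 ^ s * card {l \<in> L. \<forall>r\<in>Y'. \<not> E l r}"
      by (intro mult_left_mono card_mono) auto
    also note Y'(3)
    finally have dom: "6 ^ s * card {l \<in> L. \<forall>r\<in>insert d' Y'. \<not> E l r} \<le> card L" .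
    have "good (Suc m) X2 Y2 (c(m := c')) (d(m := d'))"
      unfolding good_def
    proof (intro conjI allI impI)
      fix i assume "i < Suc m"
      then consider "i < m" | "i = m" by linarith
      then have "X2 i \<subseteq> L \<and> Y2 i \<subseteq> R \<and> (c(m := c')) i \<in> X2 i \<and> (d(m := d')) i \<in> Y2 i
        \<and> (\<forall>x\<in>X2 i. E x ((d(m := d')) i)) \<and> (\<forall>y\<in>Y2 i. E ((c(m := c')) i) y)
        \<and> card (X2 i) \<le> s + 1 \<and> card (Y2 i) \<le> s + 1
        \<and> 6 ^ s * card {l \<in> L. \<forall>y\<in>Y2 i. \<not> E l y} \<le> card L"
      proof cases
        case 1
        then show ?thesis using g by (simp add: good_def X2_def Y2_def)
      next
        case 2
        have "X' \<subseteq> L" "Y' \<subseteq> R" "\<forall>x\<in>X'. E x d'" "\<forall>y\<in>Y'. E c' y"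
          using X'(1) Y'(1) by (auto simp: NX_def NY_def)
        then show ?thesis using 2 cards dom c'L d' by (simp add: X2_def Y2_def)
      qed
      then show "X2 i \<subseteq> L" "Y2 i \<subseteq> R" "(c(m := c')) i \<in> X2 i" "(d(m := d')) i \<in> Y2 i"
        "\<forall>x\<in>X2 i. E x ((d(m := d')) i)" "\<forall>y\<in>Y2 i. E ((c(m := c')) i) y"
        "card (X2 i) \<le> s + 1" "card (Y2 i) \<le> s + 1"
        "6 ^ s * card {l \<in> L. \<forall>y\<in>Y2 i. \<not> E l y} \<le> card L"
        by blast+
    next
      fix j i assume "j < Suc m" "i < j"
      then consider "j < m" | "j = m" "i < m" by linarith
      then have "X2 i \<inter> X2 j = {} \<and> Y2 i \<inter> Y2 j = {} \<and> (\<exists>x\<in>X2 j. \<exists>y\<in>Y2 i. E x y)"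
      proof cases
        case 1
        then show ?thesis using g \<open>i < j\<close> by (auto simp: good_def X2_def Y2_def)
      next
        case 2
        have "X i \<subseteq> UX" "Y i \<subseteq> UY" using 2 by (auto simp: UX_def UY_def)
        moreover have "X' \<inter> UX = {}" "Y' \<inter> UY = {}" using X'(1) Y'(1) by (auto simp: NX_def NY_def)
        ultimately have "X i \<inter> insert c' X' = {}" "Y i \<inter> insert d' Y' = {}" using c'L d' by auto
        then show ?thesis using 2 hit[of i] by (simp add: X2_def Y2_def)
      qed
      then show "X2 i \<inter> X2 j = {}" "Y2 i \<inter> Y2 j = {}" "\<exists>x\<in>X2 j. \<exists>y\<in>Y2 i. E x y" by auto
    qed
    then show ?case by blast
  qed
  then obtain X Y c d where g: "good h X Y c d" by blast
  show thesis
  proof (rule that[of L R X Y c d])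
    show "\<exists>r'\<in>R. r' \<noteq> r \<and> E l r'" if "l \<in> L" for l r
      using deg[OF cR _ sub(2) Lmiss[OF that]] by simp
    show "\<exists>l'\<in>L. l' \<noteq> l \<and> E l' r" if "r \<in> R" for l r
      using deg[OF cL _ sub(1) Rmiss[OF that]] by simp
    show "X i \<subseteq> L \<and> Y i \<subseteq> R \<and> c i \<in> X i \<and> d i \<in> Y i" if "i < h" for i
      using g that by (simp add: good_def)
    show "E x (d i)" if "i < h" "x \<in> X i" for i x
      using g that by (simp add: good_def)
    show "E (c i) y" if "i < h" "y \<in> Y i" for i y
      using g that by (simp add: good_def)
    show "X i \<inter> X j = {} \<and> Y i \<inter> Y j = {} \<and> (\<exists>x\<in>X j. \<exists>y\<in>Y i. E x y)" if "i < j" "j < h" for i j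
      using g that by (simp add: good_def)
  qed (fact sub)+
qed

section \<open>Sampling\<close>

lemma card_PiE_fix:
  fixes I :: "'i set"
  assumes "finite I" "J \<subseteq> I" "finite V" "\<And>j. j \<in> J \<Longrightarrow> g j \<in> V"
  shows "card {f \<in> I \<rightarrow>\<^sub>E V. \<forall>j\<in>J. f j = g j} = card V ^ (card I - card J)"
proof -
  have eq: "{f \<in> I \<rightarrow>\<^sub>E V. \<forall>j\<in>J. f j = g j} = (\<Pi>\<^sub>E i\<in>I. if i \<in> J then {g i} else V)"
    using assms by (fastforce simp: PiE_def Pi_def extensional_def split: if_splits)
  have "card {f \<in> I \<rightarrow>\<^sub>E V. \<forall>j\<in>J. f j = g j} = (\<Prod>i\<in>I. card (if i \<in> J then {g i} else V))"
    unfolding eq using assms by (intro card_PiE) auto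
  also have "\<dots> = (\<Prod>i\<in>I. if i \<in> J then 1 else card V)" by (intro prod.cong) auto
  also have "\<dots> = card V ^ card (I - J)"
    using assms by (subst prod.If_cases) (auto simp: Int_absorb1 Diff_eq)
  finally show ?thesis using assms by (simp add: card_Diff_subset finite_subset)
qed

lemma sum_PiE_apply:
  fixes g :: "'v \<Rightarrow> real"
  assumes "finite I" "i \<in> I" "finite V"
  shows "(\<Sum>f\<in>I \<rightarrow>\<^sub>E V. g (f i)) = card V ^ (card I - 1) * (\<Sum>x\<in>V. g x)"
proof -
  have fin: "finite (I \<rightarrow>\<^sub>E V)" using assms by (simp add: finite_PiE)
  have "(\<Sum>f\<in>I \<rightarrow>\<^sub>E V. g (f i)) = (\<Sum>x\<in>V. \<Sum>f | f \<in> I \<rightarrow>\<^sub>E V \<and> f i = x. g (f i))"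
    using fin assms by (intro sum.group[symmetric]) auto
  also have "\<dots> = (\<Sum>x\<in>V. card {f \<in> I \<rightarrow>\<^sub>E V. \<forall>j\<in>{i}. f j = x} * g x)"
    by (intro sum.cong) auto
  also have "\<dots> = (\<Sum>x\<in>V. card V ^ (card I - 1) * g x)"
  proof (intro sum.cong refl)
    fix x assume "x \<in> V"
    then have "card {f \<in> I \<rightarrow>\<^sub>E V. \<forall>j\<in>{i}. f j = x} = card V ^ (card I - card {i})"
      using assms by (intro card_PiE_fix) auto
    then show "card {f \<in> I \<rightarrow>\<^sub>E V. \<forall>j\<in>{i}. f j = x} * g x = card V ^ (card I - 1) * g x" by simp
  qed
  finally show ?thesis by (simp add: sum_distrib_left)
qed

lemma sum_PiE_apply2:
  fixes g :: "'v \<Rightarrow> 'v \<Rightarrow> real"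
  assumes "finite I" "i \<in> I" "j \<in> I" "i \<noteq> j" "finite V"
  shows "(\<Sum>f\<in>I \<rightarrow>\<^sub>E V. g (f i) (f j)) = card V ^ (card I - 2) * (\<Sum>x\<in>V. \<Sum>y\<in>V. g x y)"
proof -
  have fin: "finite (I \<rightarrow>\<^sub>E V)" using assms by (simp add: finite_PiE)
  have "(\<Sum>f\<in>I \<rightarrow>\<^sub>E V. g (f i) (f j))
      = (\<Sum>p\<in>V \<times> V. \<Sum>f | f \<in> I \<rightarrow>\<^sub>E V \<and> (f i, f j) = p. g (f i) (f j))"
    using fin assms by (intro sum.group[symmetric]) auto
  also have "\<dots> = (\<Sum>(x, y)\<in>V \<times> V.
      card {f \<in> I \<rightarrow>\<^sub>E V. \<forall>l\<in>{i, j}. f l = (if l = i then x else y)} * g x y)"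
    using assms(4) by (intro sum.cong) auto
  also have "\<dots> = (\<Sum>(x, y)\<in>V \<times> V. card V ^ (card I - 2) * g x y)"
  proof (intro sum.cong refl, clarify)
    fix x y assume "x \<in> V" "y \<in> V"
    then have "card {f \<in> I \<rightarrow>\<^sub>E V. \<forall>l\<in>{i, j}. f l = (if l = i then x else y)} = card V ^ (card I - card {i, j})"
      using assms by (intro card_PiE_fix) auto
    then show "card {f \<in> I \<rightarrow>\<^sub>E V. \<forall>l\<in>{i, j}. f l = (if l = i then x else y)} * g x y
        = card V ^ (card I - 2) * g x y" using assms(4) by (simp add: numeral_2_eq_2)
  qed
  finally show ?thesis by (simp add: sum.cartesian_product sum_distrib_left case_prod_unfold)
qed

text \<open>
  Both sides of the bipartite sample are drawn with replacement. A repeated vertex needs no special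
  treatment, because two routes that start or end at the same vertex cross.
\<close>

lemma exists_sample:
  fixes long :: "'v \<Rightarrow> 'v \<Rightarrow> bool" and cross :: "'v \<Rightarrow> 'v \<Rightarrow> 'v \<Rightarrow> 'v \<Rightarrow> bool"
  assumes V: "finite V" "V \<noteq> {}"
    and long: "card {(x, y) \<in> V \<times> V. long x y} \<le> \<beta> * real (card V) ^ 2"
    and cross: "(\<Sum>x\<in>V. \<Sum>x'\<in>V. \<Sum>y\<in>V. \<Sum>y'\<in>V. of_bool (cross x y x' y')) \<le> \<gamma> * real (card V) ^ 4"
  obtains w u where "w \<in> {..<k} \<rightarrow> V" "u \<in> {..<k} \<rightarrow> V"
    "card {(l, r) \<in> {..<k} \<times> {..<k}. long (w l) (u r) \<or>
       (\<exists>l'<k. \<exists>r'<k. l \<noteq> l' \<and> r \<noteq> r' \<and> cross (w l) (u r) (w l') (u r'))}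
     \<le> \<beta> * real k ^ 2 + \<gamma> * real k ^ 4"
proof -
  let ?I = "{..<k}" let ?n = "real (card V)"
  define S where "S = ?I \<rightarrow>\<^sub>E V"
  define Q where "Q = {(l, r, l', r'). l < k \<and> r < k \<and> l' < k \<and> r' < k \<and> l \<noteq> l' \<and> r \<noteq> r'}"
  define bad where "bad w u = {(l, r) \<in> ?I \<times> ?I. long (w l) (u r) \<or>
       (\<exists>l'<k. \<exists>r'<k. l \<noteq> l' \<and> r \<noteq> r' \<and> cross (w l) (u r) (w l') (u r'))}" for w u
  have npos: "?n > 0" using V by (simp add: card_gt_0_iff)
  have S: "finite S" "S \<noteq> {}" "real (card S) = ?n ^ k"
    using V by (auto simp: S_def finite_PiE PiE_eq_empty_iff card_PiE)
  have subQ: "Q \<subseteq> ?I \<times> ?I \<times> ?I \<times> ?I" by (auto simp: Q_def)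
  then have finQ: "finite Q" by (rule finite_subset) simp
  have "card Q \<le> card (?I \<times> ?I \<times> ?I \<times> ?I)" using subQ by (intro card_mono) auto
  then have cardQ: "real (card Q) \<le> real k ^ 4"
    by (simp add: card_cartesian_product power4_eq_xxxx mult.assoc flip: of_nat_mult)
  have g0: "0 \<le> \<gamma>"
  proof (rule ccontr)
    assume "\<not> 0 \<le> \<gamma>"
    then have "\<gamma> * ?n ^ 4 < 0" using npos by (simp add: mult_neg_pos)
    moreover have "0 \<le> (\<Sum>x\<in>V. \<Sum>x'\<in>V. \<Sum>y\<in>V. \<Sum>y'\<in>V. of_bool (cross x y x' y') :: real)"
      by (intro sum_nonneg) auto
    ultimately show False using cross by linarith
  qed
  have bound: "real (card (bad w u)) \<le> (\<Sum>(l, r)\<in>?I \<times> ?I. of_bool (long (w l) (u r)))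
      + (\<Sum>(l, r, l', r')\<in>Q. of_bool (cross (w l) (u r) (w l') (u r')))" for w u
  proof -
    define A where "A = {(l, r) \<in> ?I \<times> ?I. long (w l) (u r)}"
    define B where "B = {(l, r, l', r'). (l, r, l', r') \<in> Q \<and> cross (w l) (u r) (w l') (u r')}"
    have fin: "finite A" "finite B" using finQ
      by (auto simp: A_def B_def intro: finite_subset[of _ "?I \<times> ?I"] finite_subset[of _ Q])
    have "bad w u \<subseteq> A \<union> (\<lambda>(l, r, l', r'). (l, r)) ` B"
      by (force simp: bad_def A_def B_def Q_def image_iff)
    then have "card (bad w u) \<le> card (A \<union> (\<lambda>(l, r, l', r'). (l, r)) ` B)"
      using fin by (intro card_mono) auto
    also have "\<dots> \<le> card A + card B"
      using card_Un_le[of A "(\<lambda>(l, r, l', r'). (l, r)) ` B"] card_image_le[OF fin(2), of "\<lambda>(l, r, l', r'). (l, r)"]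
      by linarith
    finally have "real (card (bad w u)) \<le> real (card A) + real (card B)" by linarith
    moreover have "real (card A) = (\<Sum>(l, r)\<in>?I \<times> ?I. of_bool (long (w l) (u r)))"
      unfolding A_def case_prod_unfold of_bool_def by (simp only: sum.If_cases finite_cartesian_product finite_lessThan)
         (simp add: Int_def)
    moreover have "real (card B) = (\<Sum>(l, r, l', r')\<in>Q. of_bool (cross (w l) (u r) (w l') (u r')))"
      using finQ by (simp add: B_def case_prod_unfold of_bool_def sum.If_cases Int_def)
    ultimately show ?thesis by linarith
  qed
  have avg_long: "(\<Sum>w\<in>S. \<Sum>u\<in>S. of_bool (long (w l) (u r)) :: real) \<le> \<beta> * (?n ^ k)\<^sup>2"
    if "l < k" "r < k" for l r
  proof -
    have "(\<Sum>w\<in>S. \<Sum>u\<in>S. of_bool (long (w l) (u r)) :: real)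
        = ?n ^ (k - 1) * (?n ^ (k - 1) * (\<Sum>x\<in>V. \<Sum>y\<in>V. of_bool (long x y)))"
    proof -
      have "(\<Sum>w\<in>S. \<Sum>u\<in>S. of_bool (long (w l) (u r)) :: real)
          = (\<Sum>w\<in>S. ?n ^ (k - 1) * (\<Sum>y\<in>V. of_bool (long (w l) y)))"
        unfolding S_def using that V
        by (intro sum.cong refl) (subst sum_PiE_apply[where g = "\<lambda>y. of_bool (long _ y)"], auto)
      also have "\<dots> = ?n ^ (k - 1) * (\<Sum>w\<in>S. \<Sum>y\<in>V. of_bool (long (w l) y))"
        by (simp only: sum_distrib_left)
      also have "(\<Sum>w\<in>S. \<Sum>y\<in>V. of_bool (long (w l) y) :: real)
          = ?n ^ (k - 1) * (\<Sum>x\<in>V. \<Sum>y\<in>V. of_bool (long x y))"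
        unfolding S_def using that V
        by (subst sum_PiE_apply[where g = "\<lambda>x. \<Sum>y\<in>V. of_bool (long x y)"]) auto
      finally show ?thesis .
    qed
    also have "(\<Sum>x\<in>V. \<Sum>y\<in>V. of_bool (long x y) :: real) = card {(x, y) \<in> V \<times> V. long x y}"
      unfolding sum.cartesian_product case_prod_unfold using V
      by (subst sum_of_bool_eq) (auto intro!: arg_cong[where f = card])
    also have "?n ^ (k - 1) * (?n ^ (k - 1) * real (card {(x, y) \<in> V \<times> V. long x y}))
        \<le> ?n ^ (k - 1) * (?n ^ (k - 1) * (\<beta> * ?n ^ 2))"
      using long npos by (intro mult_left_mono) auto
    also have "\<dots> = \<beta> * (?n ^ (k - 1) * ?n)\<^sup>2" by (simp add: power2_eq_square)
    also have "?n ^ (k - 1) * ?n = ?n ^ k" by (rule power_minus_mult) (use that in simp)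
    finally show ?thesis .
  qed
  have avg_cross: "(\<Sum>w\<in>S. \<Sum>u\<in>S. of_bool (cross (w l) (u r) (w l') (u r')) :: real) \<le> \<gamma> * (?n ^ k)\<^sup>2"
    if "(l, r, l', r') \<in> Q" for l r l' r'
  proof -
    have q: "l < k" "r < k" "l' < k" "r' < k" "l \<noteq> l'" "r \<noteq> r'" using that by (auto simp: Q_def)
    have "(\<Sum>w\<in>S. \<Sum>u\<in>S. of_bool (cross (w l) (u r) (w l') (u r')) :: real)
        = (\<Sum>w\<in>S. ?n ^ (k - 2) * (\<Sum>y\<in>V. \<Sum>y'\<in>V. of_bool (cross (w l) y (w l') y')))"
      unfolding S_def using q V
      by (intro sum.cong refl)
        (subst sum_PiE_apply2[where g = "\<lambda>y y'. of_bool (cross _ y _ y')"], auto)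
    also have "\<dots> = ?n ^ (k - 2) * (\<Sum>w\<in>S. (\<Sum>y\<in>V. \<Sum>y'\<in>V. of_bool (cross (w l) y (w l') y')))"
      by (simp add: sum_distrib_left)
    also have "\<dots> = ?n ^ (k - 2) * (?n ^ (k - 2) *
        (\<Sum>x\<in>V. \<Sum>x'\<in>V. \<Sum>y\<in>V. \<Sum>y'\<in>V. of_bool (cross x y x' y')))"
      unfolding S_def using q V
      by (subst sum_PiE_apply2[where g = "\<lambda>x x'. \<Sum>y\<in>V. \<Sum>y'\<in>V. of_bool (cross x y x' y')"]) auto
    also have "\<dots> \<le> ?n ^ (k - 2) * (?n ^ (k - 2) * (\<gamma> * ?n ^ 4))"
      using cross npos by (intro mult_left_mono) auto
    also have "\<dots> = \<gamma> * (?n ^ (k - 2) * ?n ^ 2)\<^sup>2" by (simp add: power2_eq_square power4_eq_xxxx)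
    also have "?n ^ (k - 2) * ?n ^ 2 = ?n ^ k" 
    proof -
      have "k - 2 + 2 = k" using q by arith
      then show ?thesis by (metis power_add)
    qed
    finally show ?thesis .
  qed
  define M where "M = \<beta> * real k ^ 2 + \<gamma> * real k ^ 4"
  have "(\<Sum>w\<in>S. \<Sum>u\<in>S. real (card (bad w u))) \<le> (\<Sum>w\<in>S. \<Sum>u\<in>S.
      (\<Sum>(l, r)\<in>?I \<times> ?I. of_bool (long (w l) (u r)))
      + (\<Sum>(l, r, l', r')\<in>Q. of_bool (cross (w l) (u r) (w l') (u r'))))"
    by (intro sum_mono bound)
  also have "\<dots> = (\<Sum>(l, r)\<in>?I \<times> ?I. \<Sum>w\<in>S. \<Sum>u\<in>S. of_bool (long (w l) (u r)))
      + (\<Sum>(l, r, l', r')\<in>Q. \<Sum>w\<in>S. \<Sum>u\<in>S. of_bool (cross (w l) (u r) (w l') (u r')))"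
    by (simp add: sum.distrib case_prod_unfold sum.swap[of _ _ "?I \<times> ?I"] sum.swap[of _ _ Q])
  also have "\<dots> \<le> (\<Sum>(l, r)\<in>?I \<times> ?I. \<beta> * (?n ^ k)\<^sup>2) + (\<Sum>(l, r, l', r')\<in>Q. \<gamma> * (?n ^ k)\<^sup>2)"
    using avg_long avg_cross by (intro add_mono sum_mono) (force simp: Q_def)+
  also have "\<dots> = (?n ^ k)\<^sup>2 * (\<beta> * real k ^ 2 + \<gamma> * card Q)"
    by (simp add: case_prod_unfold card_cartesian_product algebra_simps power2_eq_square)
  also have "\<dots> \<le> (?n ^ k)\<^sup>2 * M"
    unfolding M_def using g0 cardQ by (intro mult_left_mono add_left_mono) auto
  finally have total: "(\<Sum>w\<in>S. \<Sum>u\<in>S. real (card (bad w u))) \<le> (?n ^ k)\<^sup>2 * M" .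
  have "\<exists>w\<in>S. \<exists>u\<in>S. card (bad w u) \<le> M"
  proof (rule ccontr)
    assume "\<not> ?thesis"
    then have "(\<Sum>w\<in>S. \<Sum>u\<in>S. M) < (\<Sum>w\<in>S. \<Sum>u\<in>S. real (card (bad w u)))"
      using S by (intro sum_strict_mono) (auto simp: not_le)
    with total S show False by (simp add: power2_eq_square mult.assoc)
  qed
  then obtain w u where "w \<in> S" "u \<in> S" "card (bad w u) \<le> M" by auto
  then show thesis using that[of w u] by (auto simp: S_def bad_def M_def PiE_def)
qed

section \<open>Trees of light load\<close>

definition path_tree :: "('a, 'b) pre_digraph \<Rightarrow> 'a \<Rightarrow> ('a \<Rightarrow> 'a list) \<Rightarrow> bool" where
  "path_tree G w t \<longleftrightarrow> (\<forall>u \<in> verts G. vpath (t u) G \<and> hd (t u) = w \<and> last (t u) = u \<and>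
     (\<forall>y \<in> set (t u). \<exists>q. t u = t y @ q))"

lemma vpath_snoc_iff:
  assumes "p \<noteq> []"
  shows "vpath (p @ [x]) G \<longleftrightarrow> vpath p G \<and> x \<in> verts G \<and> last p \<rightarrow>\<^bsub>G\<^esub> x \<and> x \<notin> set p"
  using assms by (auto simp: vpath_def vwalk_def vwalk_arcs_append)

lemma exists_shortest_path_tree:
  fixes s :: "'a \<Rightarrow> nat" and G :: "('a, 'b) pre_digraph"
  assumes fin: "finite (verts G)" and w: "w \<in> verts G"
    and pos: "\<And>v. v \<in> verts G \<Longrightarrow> s v > 0"
    and conn: "\<And>u. u \<in> verts G \<Longrightarrow> \<exists>p. vpath p G \<and> hd p = w \<and> last p = u"
  obtains t where "path_tree G w t"
    "\<And>p. vpath p G \<Longrightarrow> hd p = w \<Longrightarrow> sum s (set (t (last p))) \<le> sum s (set p)"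
proof -
  define d where "d u = (LEAST m. \<exists>p. vpath p G \<and> hd p = w \<and> last p = u \<and> sum s (set p) = m)" for u
  have d_le: "d u \<le> sum s (set p)" if "vpath p G" "hd p = w" "last p = u" for u p
    unfolding d_def using that by (intro Least_le) auto
  have d_ex: "\<exists>p. vpath p G \<and> hd p = w \<and> last p = u \<and> sum s (set p) = d u" if "u \<in> verts G" for u
    unfolding d_def by (rule LeastI_ex) (use conn[OF that] in blast)
  define ok where "ok U t \<longleftrightarrow> U \<subseteq> verts G \<and> w \<in> U \<and> (\<forall>u\<in>U. vpath (t u) G \<and> hd (t u) = w \<and> last (t u) = u \<and>
     sum s (set (t u)) = d u \<and> set (t u) \<subseteq> U \<and> (\<forall>y\<in>set (t u). \<exists>q. t u = t y @ q))" for U t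
  have start: "ok {w} (\<lambda>_. [w])"
  proof -
    obtain p where p: "vpath p G" "hd p = w" "last p = w" "sum s (set p) = d w" using d_ex[OF w] by auto
    have "w \<in> set p" using p(1,2) by (auto simp: vpath_def vwalk_def)
    then have "s w \<le> d w" using p(4) member_le_sum[of w "set p" s] by auto
    moreover have "d w \<le> sum s (set [w])" by (rule d_le) (use w in \<open>auto simp: vpath_def\<close>)
    ultimately show ?thesis using w by (auto simp: ok_def vpath_def)
  qed
  have extend: "\<exists>x t'. x \<notin> U \<and> ok (insert x U) t'" if ok: "ok U t" and ne: "U \<noteq> verts G" for U t
  proof -
    have "\<exists>x. x \<in> verts G - U" using ok ne by (auto simp: ok_def)
    from ex_has_least_nat[of "\<lambda>x. x \<in> verts G - U" _ d] this
    obtain x where x: "x \<in> verts G" "x \<notin> U" "\<And>y. y \<in> verts G \<Longrightarrow> y \<notin> U \<Longrightarrow> d x \<le> d y" by blast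
    obtain p where p: "vpath p G" "hd p = w" "last p = x" "sum s (set p) = d x" using d_ex[OF x(1)] by auto
    define r where "r = butlast p"
    have pr: "p = r @ [x]" using p(1,3) by (auto simp: r_def vpath_def vwalk_def)
    have rne: "r \<noteq> []" using p(2) pr ok x(2) by (auto simp: ok_def)
    then have r: "vpath r G" "last r \<rightarrow>\<^bsub>G\<^esub> x" "x \<notin> set r" 
      using p(1)[unfolded pr vpath_snoc_iff[OF rne]] by auto
    define y where "y = last r"
    have yV: "y \<in> verts G" using r(1) rne by (auto simp: y_def vpath_def vwalk_def)
    have "d y \<le> sum s (set r)" using p(2) pr rne r(1) by (intro d_le) (auto simp: y_def)
    moreover have "sum s (set r) + s x = d x" using p(4) pr r(3) by simp
    ultimately have dy: "d y + s x \<le> d x" by linarith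
    then have yU: "y \<in> U" using x(3)[OF yV] pos[OF x(1)] by force
    have ty: "vpath (t y) G" "hd (t y) = w" "last (t y) = y" "sum s (set (t y)) = d y" "set (t y) \<subseteq> U"
      "\<And>z. z \<in> set (t y) \<Longrightarrow> \<exists>q. t y = t z @ q" using ok yU by (auto simp: ok_def)
    have tyne: "t y \<noteq> []" using ty(1) by (auto simp: vpath_def vwalk_def)
    have xy: "x \<notin> set (t y)" using ty(5) x(2) by auto
    have new: "vpath (t y @ [x]) G" "hd (t y @ [x]) = w"
      using ty tyne x r(2) xy by (auto simp: vpath_snoc_iff y_def)
    have "d x \<le> sum s (set (t y @ [x]))" using new by (intro d_le) auto
    moreover have sum_new: "sum s (set (t y @ [x])) = d y + s x" using xy ty(4) by simp
    ultimately have cost: "sum s (set (t y @ [x])) = d x" using dy by linarith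
    define t' where "t' = t(x := t y @ [x])"
    have t': "t' x = t y @ [x]" "\<And>u. u \<in> U \<Longrightarrow> t' u = t u" using x(2) by (auto simp: t'_def)
    have "\<exists>q. t' x = t' z @ q" if "z \<in> set (t' x)" for z
    proof (cases "z = x")
      case False
      then have z: "z \<in> set (t y)" using that t'(1) by auto
      from ty(6)[OF z] obtain q where "t y = t z @ q" by blast
      moreover have "z \<in> U" using z ty(5) by blast
      ultimately show ?thesis using t' by simp
    qed simp
    then have at_x: "vpath (t' x) G \<and> hd (t' x) = w \<and> last (t' x) = x \<and> sum s (set (t' x)) = d x \<and>
        set (t' x) \<subseteq> insert x U \<and> (\<forall>z\<in>set (t' x). \<exists>q. t' x = t' z @ q)"
      using new cost ty(5) t'(1) by fastforce
    have at_u: "vpath (t' u) G \<and> hd (t' u) = w \<and> last (t' u) = u \<and> sum s (set (t' u)) = d u \<and>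
        set (t' u) \<subseteq> insert x U \<and> (\<forall>z\<in>set (t' u). \<exists>q. t' u = t' z @ q)" if "u \<in> U" for u
    proof -
      have u: "vpath (t u) G" "hd (t u) = w" "last (t u) = u" "sum s (set (t u)) = d u" "set (t u) \<subseteq> U"
        "\<And>z. z \<in> set (t u) \<Longrightarrow> \<exists>q. t u = t z @ q" using ok that by (auto simp: ok_def)
      have "\<exists>q. t' u = t' z @ q" if "z \<in> set (t' u)" for z
        using u(5) u(6)[of z] that t'(2) \<open>u \<in> U\<close> by (metis subsetD)
      with u t'(2)[OF that] show ?thesis by (auto simp: subset_insertI2)
    qed
    have "ok (insert x U) t'"
      using ok x(1) at_x at_u unfolding ok_def by blast
    with x(2) show ?thesis by blast
  qed
  have "\<exists>U t. ok U t \<and> card U = m" if "1 \<le> m" "m \<le> card (verts G)" for m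
    using that
  proof (induction m rule: dec_induct)
    case base
    then show ?case using start by force
  next
    case (step m)
    then obtain U t where U: "ok U t" "card U = m" by auto
    with step.prems have "U \<noteq> verts G" by auto
    then obtain x t' where "x \<notin> U" "ok (insert x U) t'" using extend U(1) by blast
    moreover have "finite U" using U(1) fin by (auto simp: ok_def intro: finite_subset)
    ultimately show ?case using U(2) by (metis card_insert_disjoint)
  qed
  moreover have "1 \<le> card (verts G)" using fin w by (metis One_nat_def Suc_leI card_gt_0_iff empty_iff)
  ultimately obtain U t where U: "ok U t" "card U = card (verts G)" by blast
  have "U = verts G" using U card_subset_eq[OF fin, of U] by (simp add: ok_def)
  with U have t: "ok (verts G) t" by simp
  show thesis
  proof (rule that[of t])
    show "path_tree G w t" using t by (auto simp: ok_def path_tree_def)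
    fix p assume p: "vpath p G" "hd p = w"
    then have "last p \<in> verts G" by (auto simp: vpath_def vwalk_def)
    then show "sum s (set (t (last p))) \<le> sum s (set p)" using t d_le[OF p] by (auto simp: ok_def)
  qed
qed

lemma vpath_rev: "symmetric G \<Longrightarrow> vpath p G \<Longrightarrow> vpath (rev p) G"
  by (simp add: vpath_def vwalk_rev_ex)

definition load :: "('a, 'b) pre_digraph \<Rightarrow> ('a \<Rightarrow> 'a list) \<Rightarrow> 'a \<Rightarrow> nat" where
  "load G t v = card {u \<in> verts G. v \<in> set (t u)}"

text \<open>The indicator stands for the trivial path that a tree with source \<open>w\<close> contains.\<close>

definition source_load :: "('a, 'b) pre_digraph \<Rightarrow> ('a list \<Rightarrow> real) \<Rightarrow> 'a \<Rightarrow> 'a \<Rightarrow> real" where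
  "source_load G F w v = of_bool (v = w) +
     (\<Sum>u \<in> verts G - {w}. \<Sum>p | p \<in> paths_between G w u \<and> v \<in> set p. F p)"

lemma sum_load:
  fixes s :: "'a \<Rightarrow> nat" and G :: "('a, 'b) pre_digraph"
  assumes "finite (verts G)" "path_tree G w t"
  shows "(\<Sum>v\<in>verts G. s v * load G t v) = (\<Sum>u\<in>verts G. sum s (set (t u)))"
proof -
  have "(\<Sum>v\<in>verts G. s v * load G t v) = (\<Sum>v\<in>verts G. \<Sum>u\<in>verts G. if v \<in> set (t u) then s v else 0)"
    using assms(1) by (intro sum.cong refl) (simp add: load_def sum.If_cases Int_def)
  also have "\<dots> = (\<Sum>u\<in>verts G. \<Sum>v\<in>verts G. if v \<in> set (t u) then s v else 0)"
    by (rule sum.swap)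
  also have "\<dots> = (\<Sum>u\<in>verts G. sum s (set (t u)))"
  proof (rule sum.cong[OF refl])
    fix u assume "u \<in> verts G"
    then have "set (t u) \<subseteq> verts G" using assms(2) by (auto simp: path_tree_def vpath_def vwalk_def)
    then show "(\<Sum>v\<in>verts G. if v \<in> set (t u) then s v else 0) = sum s (set (t u))"
      using assms(1) by (simp add: sum.If_cases Int_absorb1 flip: Int_def)
  qed
  finally show ?thesis .
qed

locale complete_flow =
  fixes G :: "('a, 'b) pre_digraph" and F :: "'a list \<Rightarrow> real"
  assumes graph: "graph G" and flow: "unit_complete_flow G F" and two_verts: "2 \<le> card (verts G)"
begin

sublocale graph G by (rule graph)

abbreviation "V \<equiv> verts G"

lemma F_nonneg: "vpath p G \<Longrightarrow> 0 \<le> F p"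
  using flow by (auto simp: unit_complete_flow_def is_flow_def)

lemma unit: "u \<in> V \<Longrightarrow> v \<in> V \<Longrightarrow> u \<noteq> v \<Longrightarrow> (\<Sum>p\<in>paths_between G u v. F p) = 1"
  using flow by (auto simp: unit_complete_flow_def)

lemma finite_paths [simp]: "finite (paths_between G u v)"
  by (rule finite_subset[OF _ vpaths_finite]) (auto simp: paths_between_def)

lemma paths_betweenD:
  assumes "p \<in> paths_between G u v"
  shows "vpath p G" "set p \<subseteq> V" "u \<in> set p" "v \<in> set p"
proof -
  show "vpath p G" using assms by (simp add: paths_between_def)
  then have "p \<noteq> []" and "set p \<subseteq> V" by (auto simp: vpath_def vwalk_def)
  then have "{hd p, last p} \<subseteq> set p" by auto
  moreover have "{hd p, last p} = {u, v}" using assms by (simp add: paths_between_def)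
  ultimately show "set p \<subseteq> V" "u \<in> set p" "v \<in> set p" using \<open>set p \<subseteq> V\<close> by blast+
qed

lemma oriented_path:
  assumes "p \<in> paths_between G u v"
  obtains q where "vpath q G" "hd q = u" "last q = v" "set q = set p"
proof (cases "hd p = u \<and> last p = v")
  case True
  then show ?thesis using assms that[of p] by (auto simp: paths_between_def)
next
  case False
  then have "hd p = v" "last p = u" using assms by (auto simp: paths_between_def doubleton_eq_iff)
  then show ?thesis using assms that[of "rev p"] sym_arcs
    by (auto simp: paths_between_def vpath_rev hd_rev last_rev)
qed

lemma connecting_path:
  assumes "u \<in> V" "v \<in> V"
  shows "\<exists>p. vpath p G \<and> hd p = u \<and> last p = v"
proof (cases "u = v")
  case True
  then show ?thesis using assms by (intro exI[of _ "[u]"]) (auto simp: vpath_def)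
next
  case False
  then have "paths_between G u v \<noteq> {}" using unit[OF assms] by auto
  then show ?thesis by (meson all_not_in_conv oriented_path)
qed

lemma through_nonneg: "0 \<le> (\<Sum>p | p \<in> paths_between G w u \<and> v \<in> set p. F p)"
  by (intro sum_nonneg) (auto intro: F_nonneg paths_betweenD)

lemma source_load_ge_1:
  assumes "w \<in> V" "v \<in> V"
  shows "1 \<le> source_load G F w v"
proof (cases "v = w")
  case True
  then show ?thesis by (auto simp: source_load_def intro!: sum_nonneg through_nonneg)
next
  case False
  have "{p. p \<in> paths_between G w v \<and> v \<in> set p} = paths_between G w v"
    by (auto dest: paths_betweenD)
  then have "1 = (\<Sum>p | p \<in> paths_between G w v \<and> v \<in> set p. F p)"
    using unit[OF assms] False by simp
  also have "\<dots> \<le> (\<Sum>u \<in> V - {w}. \<Sum>p | p \<in> paths_between G w u \<and> v \<in> set p. F p)"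
    using False assms by (intro member_le_sum[of v]) (auto simp: through_nonneg)
  finally show ?thesis using False by (simp add: source_load_def)
qed

lemma congestion_ge_1:
  assumes "v \<in> V"
  shows "1 \<le> congestion G F v"
proof -
  have "\<not> V \<subseteq> {v}" using two_verts card_mono[of "{v}" V] by auto
  then obtain u where u: "u \<in> V" "u \<noteq> v" by auto
  have "1 = (\<Sum>p\<in>paths_between G v u. F p)" using unit[OF assms u(1)] u(2) by simp
  also have "\<dots> \<le> congestion G F v"
    unfolding congestion_def using vpaths_finite
    by (intro sum_mono2) (auto dest: paths_betweenD F_nonneg)
  finally show ?thesis .
qed

lemma sum_source_load_le:
  assumes "v \<in> V"
  shows "(\<Sum>w\<in>V. source_load G F w v) \<le> 3 * congestion G F v"
proof -
  define P where "P = {p. vpath p G \<and> v \<in> set p}"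
  have finP: "finite P" using vpaths_finite by (auto simp: P_def)
  have "(\<Sum>w\<in>V. \<Sum>u\<in>V - {w}. \<Sum>p | p \<in> paths_between G w u \<and> v \<in> set p. F p)
      = (\<Sum>w\<in>V. \<Sum>u\<in>V - {w}. \<Sum>p\<in>P. if {hd p, last p} = {w, u} then F p else 0)"
  proof (rule sum.cong[OF refl], rule sum.cong[OF refl])
    fix w u
    have "{p. p \<in> paths_between G w u \<and> v \<in> set p} = P \<inter> {p. {hd p, last p} = {w, u}}"
      by (auto simp: P_def paths_between_def)
    then show "(\<Sum>p | p \<in> paths_between G w u \<and> v \<in> set p. F p)
        = (\<Sum>p\<in>P. if {hd p, last p} = {w, u} then F p else 0)"
      by (simp only: sum.If_cases[OF finP]) simp
  qed
  also have "\<dots> = (\<Sum>(w, u)\<in>Sigma V (\<lambda>w. V - {w}). \<Sum>p\<in>P. if {hd p, last p} = {w, u} then F p else 0)"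
    by (rule sum.Sigma) auto
  also have "\<dots> = (\<Sum>p\<in>P. \<Sum>(w, u)\<in>Sigma V (\<lambda>w. V - {w}). if {hd p, last p} = {w, u} then F p else 0)"
    unfolding case_prod_unfold by (rule sum.swap)
  also have "\<dots> \<le> (\<Sum>p\<in>P. 2 * F p)"
  proof (rule sum_mono)
    fix p assume "p \<in> P"
    then have F: "0 \<le> F p" by (auto simp: P_def F_nonneg)
    let ?S = "{x \<in> Sigma V (\<lambda>w. V - {w}). {hd p, last p} = {fst x, snd x}}"
    have "?S \<subseteq> {(hd p, last p), (last p, hd p)}" by (auto simp: doubleton_eq_iff)
    then have "card ?S \<le> card {(hd p, last p), (last p, hd p)}" by (intro card_mono) auto
    also have "card {a, b} \<le> 2" for a b :: "'a \<times> 'a" by (simp add: card_insert_if)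
    finally have "card ?S \<le> 2" .
    then have "card ?S * F p \<le> 2 * F p" using F by (intro mult_right_mono) auto
    then show "(\<Sum>(w, u)\<in>Sigma V (\<lambda>w. V - {w}). if {hd p, last p} = {w, u} then F p else 0) \<le> 2 * F p"
      by (simp add: case_prod_unfold sum.If_cases Int_def)
  qed
  also have "\<dots> = 2 * congestion G F v" by (simp add: congestion_def P_def sum_distrib_left)
  finally show ?thesis
    using assms congestion_ge_1[OF assms] by (simp add: source_load_def sum.distrib)
qed

lemma shortest_path_tree_cost_le:
  fixes s :: "'a \<Rightarrow> nat"
  assumes t: "path_tree G w t" and w: "w \<in> V"
    and short: "\<And>p. vpath p G \<Longrightarrow> hd p = w \<Longrightarrow> sum s (set (t (last p))) \<le> sum s (set p)"
  shows "(\<Sum>v\<in>V. s v * load G t v) \<le> (\<Sum>v\<in>V. s v * source_load G F w v)"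
proof -
  have at_w: "real (sum s (set (t w))) \<le> s w"
    using short[of "[w]"] w by (simp add: vpath_def del: of_nat_sum)
  have at_u: "real (sum s (set (t u))) \<le> (\<Sum>v\<in>V. s v * (\<Sum>p | p \<in> paths_between G w u \<and> v \<in> set p. F p))"
    if u: "u \<in> V - {w}" for u
  proof -
    have "real (sum s (set (t u))) = (\<Sum>p\<in>paths_between G w u. F p * sum s (set (t u)))"
      unfolding sum_distrib_right[symmetric] using unit[OF w, of u] u by auto
    also have "\<dots> \<le> (\<Sum>p\<in>paths_between G w u. F p * sum s (set p))"
    proof (rule sum_mono)
      fix p assume p: "p \<in> paths_between G w u"
      then obtain q where "vpath q G" "hd q = w" "last q = u" "set q = set p" by (rule oriented_path)
      then have "sum s (set (t u)) \<le> sum s (set p)" using short[of q] by simp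
      then show "F p * sum s (set (t u)) \<le> F p * sum s (set p)"
        using F_nonneg[OF paths_betweenD(1)[OF p]] by (intro mult_left_mono of_nat_mono)
    qed
    also have "\<dots> = (\<Sum>p\<in>paths_between G w u. \<Sum>v\<in>V. if v \<in> set p then s v * F p else 0)"
    proof (rule sum.cong[OF refl])
      fix p assume p: "p \<in> paths_between G w u"
      show "F p * sum s (set p) = (\<Sum>v\<in>V. if v \<in> set p then s v * F p else 0)"
        using paths_betweenD(2)[OF p]
        by (simp add: sum.If_cases Int_absorb1 sum_distrib_left mult.commute flip: Int_def)
    qed
    also have "\<dots> = (\<Sum>v\<in>V. \<Sum>p\<in>paths_between G w u. if v \<in> set p then s v * F p else 0)"
      by (rule sum.swap)
    also have "\<dots> = (\<Sum>v\<in>V. s v * (\<Sum>p | p \<in> paths_between G w u \<and> v \<in> set p. F p))"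
      by (simp add: sum.If_cases sum_distrib_left Int_def)
    finally show ?thesis .
  qed
  have "real (\<Sum>v\<in>V. s v * load G t v) = real (sum s (set (t w))) + (\<Sum>u\<in>V - {w}. real (sum s (set (t u))))"
    unfolding sum_load[OF finite_verts t] using w by (simp add: sum.remove[of V w])
  also have "\<dots> \<le> s w + (\<Sum>u\<in>V - {w}. \<Sum>v\<in>V. s v * (\<Sum>p | p \<in> paths_between G w u \<and> v \<in> set p. F p))"
    by (intro add_mono at_w sum_mono at_u)
  also have "\<dots> = s w + (\<Sum>v\<in>V. s v * (\<Sum>u\<in>V - {w}. \<Sum>p | p \<in> paths_between G w u \<and> v \<in> set p. F p))"
    by (subst sum.swap) (simp add: sum_distrib_left)
  also have "real (s w) = (\<Sum>v\<in>V. s v * of_bool (v = w))" using w by simp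
  also have "\<dots> + (\<Sum>v\<in>V. s v * (\<Sum>u\<in>V - {w}. \<Sum>p | p \<in> paths_between G w u \<and> v \<in> set p. F p))
      = (\<Sum>v\<in>V. s v * source_load G F w v)"
    by (simp add: source_load_def distrib_left sum.distrib)
  finally show ?thesis .
qed

lemma load_bounds:
  assumes "path_tree G w t" "v \<in> V"
  shows "1 \<le> load G t v" "load G t v \<le> card V"
proof -
  have "v \<in> {u \<in> V. v \<in> set (t u)}"
    using assms by (auto simp: path_tree_def vpath_def vwalk_def) (metis last_in_set)
  moreover have "finite {u \<in> V. v \<in> set (t u)}" by simp
  ultimately have "0 < card {u \<in> V. v \<in> set (t u)}" using card_gt_0_iff by blast
  then show "1 \<le> load G t v" by (simp add: load_def)
  show "load G t v \<le> card V" unfolding load_def by (intro card_mono) auto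
qed

text \<open>
  Take a family with the least total squared load. Exchanging the tree at \<open>w\<close> for a shortest-path tree,
  with respect to the weights given by the derivative of the objective, cannot improve it.
\<close>

lemma exists_light_path_trees:
  obtains T where "\<And>w. w \<in> V \<Longrightarrow> path_tree G w (T w)"
    "(\<Sum>v\<in>V. (\<Sum>w\<in>V. real (load G (T w) v))\<^sup>2) \<le> 54 * (con2 G F)\<^sup>2"
proof -
  define N where "N = card V"
  define fam where "fam T \<longleftrightarrow> (\<forall>w\<in>V. path_tree G w (T w))" for T
  define cost where "cost T = (\<Sum>v\<in>V. (\<Sum>w\<in>V. load G (T w) v)\<^sup>2)" for T
  have tree: "\<exists>t. path_tree G w t \<and>
      (\<forall>p. vpath p G \<longrightarrow> hd p = w \<longrightarrow> sum s (set (t (last p))) \<le> sum s (set p))"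
    if "w \<in> V" "\<And>v. v \<in> V \<Longrightarrow> s v > 0" for w and s :: "'a \<Rightarrow> nat"
    by (rule exists_shortest_path_tree[of G w s]) (use that connecting_path in auto)
  have "\<exists>T. fam T" unfolding fam_def
    using tree[of _ "\<lambda>_. 1"] by (intro bchoice) auto
  then obtain T where T: "fam T" and T_min: "\<And>T'. fam T' \<Longrightarrow> cost T \<le> cost T'"
    using ex_has_least_nat[of fam _ cost] by blast
  define X where "X w v = real (load G (T w) v)" for w v
  define Y where "Y v = (\<Sum>w\<in>V. X w v)" for v
  define \<phi> where "\<phi> v = (\<Sum>w\<in>V. source_load G F w v)" for v
  have Npos: "N > 0" using two_verts by (simp add: N_def)
  have X_le: "X w v \<le> N" and X_ge: "1 \<le> X w v" if "w \<in> V" "v \<in> V" for w v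
    using load_bounds[of w "T w" v] T that by (auto simp: X_def N_def fam_def)
  have Y_ge: "N \<le> Y v" if "v \<in> V" for v
    using sum_mono[of V "\<lambda>_. 1" "\<lambda>w. X w v"] X_ge that by (simp add: Y_def N_def)
  have \<phi>_ge: "N \<le> \<phi> v" if "v \<in> V" for v
    using sum_mono[of V "\<lambda>_. 1" "\<lambda>w. source_load G F w v"] source_load_ge_1 that by (simp add: \<phi>_def N_def)
  have opt: "(\<Sum>v\<in>V. (2 * Y v - N) * X w v) \<le> (\<Sum>v\<in>V. (2 * Y v + N) * source_load G F w v)"
    if w: "w \<in> V" for w
  proof -
    define Z where "Z v = (\<Sum>w'\<in>V - {w}. load G (T w') v)" for v
    define s where "s v = 2 * Z v + N" for v
    obtain t where t: "path_tree G w t"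
      "\<And>p. vpath p G \<Longrightarrow> hd p = w \<Longrightarrow> sum s (set (t (last p))) \<le> sum s (set p)"
      using tree[OF w, of s] Npos by (auto simp: s_def)
    have YZ: "Y v = Z v + X w v" for v
      using w by (simp add: Y_def X_def Z_def sum.remove[of V w])
    have "fam (T(w := t))" using T t(1) by (auto simp: fam_def)
    from T_min[OF this] have "cost T \<le> cost (T(w := t))" .
    moreover have "cost T = (\<Sum>v\<in>V. (load G (T w) v + Z v)\<^sup>2)"
      unfolding cost_def Z_def using w by (simp add: sum.remove[of V w])
    moreover have "cost (T(w := t)) = (\<Sum>v\<in>V. (load G t v + Z v)\<^sup>2)"
    proof -
      have "(\<Sum>w'\<in>V. load G ((T(w := t)) w') v) = load G t v + Z v" for v
        unfolding Z_def using w by (simp add: sum.remove[of V w])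
      then show ?thesis by (simp add: cost_def)
    qed
    ultimately have "(\<Sum>v\<in>V. (load G (T w) v + Z v)\<^sup>2) \<le> (\<Sum>v\<in>V. (load G t v + Z v)\<^sup>2)" by simp
    then have "real (\<Sum>v\<in>V. (load G (T w) v + Z v)\<^sup>2) \<le> real (\<Sum>v\<in>V. (load G t v + Z v)\<^sup>2)"
      by (rule of_nat_mono)
    then have "(\<Sum>v\<in>V. 2 * Z v * X w v + (X w v)\<^sup>2) \<le> (\<Sum>v\<in>V. 2 * Z v * real (load G t v) + (real (load G t v))\<^sup>2)"
      by (simp add: power2_sum sum.distrib X_def algebra_simps)
    moreover have "(\<Sum>v\<in>V. (2 * Y v - N) * X w v) \<le> (\<Sum>v\<in>V. 2 * Z v * X w v + (X w v)\<^sup>2)"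
    proof (rule sum_mono)
      fix v assume "v \<in> V"
      then have "X w v * X w v \<le> N * X w v" using X_le[OF w] X_ge[OF w, of v] by (intro mult_right_mono) auto
      then show "(2 * Y v - N) * X w v \<le> 2 * Z v * X w v + (X w v)\<^sup>2"
        by (simp add: YZ power2_eq_square algebra_simps)
    qed
    moreover have "(\<Sum>v\<in>V. 2 * Z v * real (load G t v) + (real (load G t v))\<^sup>2) \<le> (\<Sum>v\<in>V. s v * load G t v)"
    proof -
      have "2 * Z v * real (load G t v) + (real (load G t v))\<^sup>2 \<le> real (s v * load G t v)" if "v \<in> V" for v
        using mult_right_mono[OF load_bounds(2)[OF t(1) that], of "load G t v"]
        by (simp add: s_def N_def power2_eq_square algebra_simps flip: of_nat_mult)
      then show ?thesis by (simp add: sum_mono)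
    qed
    moreover have "real (\<Sum>v\<in>V. s v * load G t v) \<le> (\<Sum>v\<in>V. s v * source_load G F w v)"
      using t w by (intro shortest_path_tree_cost_le) auto
    moreover have "(\<Sum>v\<in>V. s v * source_load G F w v) \<le> (\<Sum>v\<in>V. (2 * Y v + N) * source_load G F w v)"
    proof (intro sum_mono mult_right_mono)
      fix v assume v: "v \<in> V"
      show "real (s v) \<le> 2 * Y v + N" using X_ge[OF w v] by (simp add: s_def YZ)
      show "0 \<le> source_load G F w v" using source_load_ge_1[OF w v] by linarith
    qed
    ultimately show ?thesis by linarith
  qed
  have "(\<Sum>v\<in>V. (2 * Y v - N) * Y v) = (\<Sum>w\<in>V. \<Sum>v\<in>V. (2 * Y v - N) * X w v)"
    by (subst sum.swap) (simp add: Y_def sum_distrib_left)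
  also have "\<dots> \<le> (\<Sum>w\<in>V. \<Sum>v\<in>V. (2 * Y v + N) * source_load G F w v)"
    by (intro sum_mono opt)
  also have "\<dots> = (\<Sum>v\<in>V. (2 * Y v + N) * \<phi> v)"
    by (subst sum.swap) (simp add: \<phi>_def sum_distrib_left)
  finally have main: "(\<Sum>v\<in>V. (2 * Y v - N) * Y v) \<le> (\<Sum>v\<in>V. (2 * Y v + N) * \<phi> v)" .
  have "(\<Sum>v\<in>V. (Y v)\<^sup>2) \<le> (\<Sum>v\<in>V. (2 * Y v - N) * Y v)"
  proof (rule sum_mono)
    fix v assume "v \<in> V"
    then have "Y v * Y v \<le> (2 * Y v - N) * Y v"
      using Y_ge[of v] Npos by (intro mult_right_mono) auto
    then show "(Y v)\<^sup>2 \<le> (2 * Y v - N) * Y v" by (simp add: power2_eq_square)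
  qed
  also note main
  also have "(\<Sum>v\<in>V. (2 * Y v + N) * \<phi> v) \<le> (\<Sum>v\<in>V. (Y v)\<^sup>2 / 2 + 3 * (\<phi> v)\<^sup>2)"
  proof (rule sum_mono)
    fix v assume "v \<in> V"
    then have "N * \<phi> v \<le> \<phi> v * \<phi> v" using \<phi>_ge[of v] Npos by (intro mult_right_mono) auto
    moreover have "0 \<le> (Y v - 2 * \<phi> v)\<^sup>2 / 2" by simp
    ultimately show "(2 * Y v + N) * \<phi> v \<le> (Y v)\<^sup>2 / 2 + 3 * (\<phi> v)\<^sup>2"
      by (simp add: power2_eq_square algebra_simps)
  qed
  finally have "(\<Sum>v\<in>V. (Y v)\<^sup>2) \<le> 6 * (\<Sum>v\<in>V. (\<phi> v)\<^sup>2)"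
    by (simp add: sum.distrib flip: sum_divide_distrib sum_distrib_left)
  also have "(\<Sum>v\<in>V. (\<phi> v)\<^sup>2) \<le> (\<Sum>v\<in>V. (3 * congestion G F v)\<^sup>2)"
  proof (intro sum_mono power_mono)
    fix v assume v: "v \<in> V"
    show "\<phi> v \<le> 3 * congestion G F v" using sum_source_load_le[OF v] by (simp add: \<phi>_def)
    show "0 \<le> \<phi> v" using \<phi>_ge[OF v] by simp
  qed
  also have "\<dots> = 9 * (con2 G F)\<^sup>2"
    by (simp add: con2_def power_mult_distrib sum_nonneg flip: sum_distrib_left)
  finally show thesis using that[of T] T by (simp add: fam_def Y_def X_def)
qed

end

section \<open>From routes to branch sets\<close>

lemma vwalk_induce_subgraph:
  "vwalk p (G \<restriction> S) \<longleftrightarrow> set p \<subseteq> S \<and> set (vwalk_arcs p) \<subseteq> arcs_ends G \<and> p \<noteq> []"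
proof -
  have "arcs_ends (G \<restriction> S) = {(u, v) \<in> arcs_ends G. u \<in> S \<and> v \<in> S}"
    by (auto simp: arcs_ends_conv)
  moreover have "set (vwalk_arcs p) \<subseteq> S \<times> S" if "set p \<subseteq> S"
    using that by (auto elim!: in_set_vwalk_arcsE)
  ultimately show ?thesis unfolding vwalk_def by auto
qed

lemma vwalk_prefix:
  assumes "vwalk p G" "x \<in> set p"
  obtains q where "vwalk q G" "hd q = hd p" "last q = x" "set q \<subseteq> set p" "length q \<le> length p"
proof -
  obtain a b where p: "p = a @ x # b" using assms(2) by (meson split_list)
  then have "vwalk (a @ [x]) G" using assms(1) set_vwalk_arcs_append1[of "a @ [x]" b] by (auto simp: vwalk_def)
  then show ?thesis by (rule that) (auto simp: p hd_append)
qed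

context graph
begin

lemma connected_induce_subgraphI:
  assumes "D \<subseteq> verts G" "r \<in> D"
    and walks: "\<And>x. x \<in> D \<Longrightarrow> \<exists>p. vwalk p (G \<restriction> D) \<and> hd p = r \<and> last p = x"
  shows "Digraph_Component.connected (G \<restriction> D)"
proof -
  interpret D: wf_digraph "G \<restriction> D" by auto
  have sym: "symmetric (G \<restriction> D)"
    using induced_graph_imp_symmetric[OF sym_arcs induced_induce[OF assms(1)]] .
  have "r \<rightarrow>\<^sup>*\<^bsub>G \<restriction> D\<^esub> x" if "x \<in> D" for x
    using walks[OF that] by (simp add: D.reachable_vwalk_conv)
  then have "x \<rightarrow>\<^sup>*\<^bsub>G \<restriction> D\<^esub> y" if "x \<in> D" "y \<in> D" for x y
    using D.reachable_trans[OF symmetric_reachable[OF sym, of r x], of y] that by simp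
  then show ?thesis
    unfolding Digraph_Component.connected_def strongly_connected_def
    using assms(2) by (auto intro: D.reachable_mk_symmetricI)
qed

definition near :: "nat \<Rightarrow> 'a \<Rightarrow> 'a \<Rightarrow> bool" where
  "near m u v \<longleftrightarrow> (\<exists>q. awalk u q v \<and> length q \<le> m)"

lemma near_trans: "near m u v \<Longrightarrow> near m' v w \<Longrightarrow> near (m + m') u w"
  unfolding near_def by (metis awalk_appendI add_mono length_append)

lemma near_mono: "near m u v \<Longrightarrow> m \<le> m' \<Longrightarrow> near m' u v"
  unfolding near_def by (meson order_trans)

lemma near_imp_dist_le: 
  assumes "near m u v"
  shows "dist_in G u v \<le> ereal (real m)"
proof -
  obtain q where q: "awalk u q v" "length q \<le> m" using assms by (auto simp: near_def)
  have "awalk_cost (\<lambda>_. 1) q = real (length q)" by (induction q) auto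
  with min_cost_le_walk_cost[OF q(1), of "\<lambda>_. 1"] have "dist_in G u v \<le> ereal (real (length q))" by simp
  also have "\<dots> \<le> ereal (real m)" using q(2) by simp
  finally show ?thesis .
qed

lemma vwalk_imp_near:
  assumes "vwalk p G" shows "near (length p) (hd p) (last p)"
proof -
  have "\<exists>q. awalk (hd p) q (last p) \<and> length q < length p"
    using assms
  proof (induction p rule: vwalk_induct)
    case (Base u)
    then show ?case by (intro exI[of _ "[]"]) (simp add: awalk_Nil_iff)
  next
    case (Cons u v es)
    obtain q where "awalk v q (last (v # es))" "length q < length (v # es)" using Cons(2) by auto
    moreover obtain e where "e \<in> arcs G" "tail G e = u" "head G e = v" using Cons(1) by auto
    ultimately show ?case by (intro exI[of _ "e # q"]) (auto simp: awalk_Cons_iff)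
  qed
  then show ?thesis by (auto simp: near_def intro: less_imp_le)
qed

lemma near_on_vwalk:
  assumes "vwalk p G" "x \<in> set p"
  shows "near (length p) (hd p) x" "near (length p) x (hd p)"
    "near (length p) (last p) x" "near (length p) x (last p)"
proof -
  have hd_near: "near (length p) (hd p) x \<and> near (length p) x (hd p)"
    if p: "vwalk p G" "x \<in> set p" for p
  proof -
    obtain q where q: "vwalk q G" "hd q = hd p" "last q = x" "length q \<le> length p"
      using vwalk_prefix[OF p] by metis
    from vwalk_imp_near[OF q(1)] vwalk_imp_near[OF vwalk_rev_ex[OF sym_arcs q(1)]] q
    show ?thesis by (auto simp: hd_rev last_rev intro: near_mono)
  qed
  show "near (length p) (hd p) x" "near (length p) x (hd p)"
    using hd_near[OF assms] by auto
  show "near (length p) (last p) x" "near (length p) x (last p)"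
    using hd_near[OF vwalk_rev_ex[OF sym_arcs assms(1)]] assms by (auto simp: hd_rev)
qed

lemma complete_minorI:
  assumes "\<And>i. i < h \<Longrightarrow> D i \<subseteq> verts G" "\<And>i. i < h \<Longrightarrow> Digraph_Component.connected (G \<restriction> D i)"
    and "\<And>i x y. i < h \<Longrightarrow> x \<in> D i \<Longrightarrow> y \<in> D i \<Longrightarrow> dist_in G x y \<le> ereal (real L)"
    and disj: "\<And>i j. i < j \<Longrightarrow> j < h \<Longrightarrow> D i \<inter> D j = {}"
    and adj: "\<And>i j. i < j \<Longrightarrow> j < h \<Longrightarrow> \<exists>x \<in> D i. \<exists>y \<in> D j. x \<rightarrow>\<^bsub>G\<^esub> y"
  shows "\<not> excludes_complete_minor h L G"
proof -
  define K :: "(nat, nat \<times> nat) pre_digraph" where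
    "K = \<lparr>verts = {..<h}, arcs = {(i, j). i < h \<and> j < h \<and> i \<noteq> j}, tail = fst, head = snd\<rparr>"
  have ends: "arcs_ends K = {(i, j). i < h \<and> j < h \<and> i \<noteq> j}"
    by (force simp: K_def arcs_ends_conv)
  have "{(i, j). i < h \<and> j < h \<and> i \<noteq> j} \<subseteq> {..<h} \<times> {..<h}" by auto
  then have "finite {(i, j). i < h \<and> j < h \<and> i \<noteq> j}" by (rule finite_subset) simp
  then have "graph K"
    by unfold_locales (auto simp: K_def arc_to_ends_def symmetric_def arcs_ends_conv sym_def image_iff)
  then have "complete_digraph h K"
    by (auto simp: complete_digraph_def ends) (auto simp: K_def)
  moreover have "minor_at_depth K L G"
    unfolding minor_at_depth_def
  proof (intro exI[of _ D] conjI allI impI ballI)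
    show "disjoint_family_on D (verts K)"
      using disj by (auto simp: disjoint_family_on_def K_def) (metis disjoint_iff linorder_neqE_nat)
    show "\<exists>x\<in>D i. \<exists>y\<in>D j. x \<rightarrow>\<^bsub>G\<^esub> y" if "i \<rightarrow>\<^bsub>K\<^esub> j" for i j
    proof -
      have "i < h" "j < h" "i \<noteq> j" using that by (auto simp: ends)
      then show ?thesis using adj[of i j] adj[of j i] arcs_ends_symmetric[OF sym_arcs]
        by (meson linorder_neqE_nat)
    qed
  qed (use assms in \<open>auto simp: K_def\<close>)
  ultimately show ?thesis unfolding excludes_complete_minor_def by blast
qed

end

text \<open>
  Routes with a common start are assumed to share everything that precedes a common vertex, so a
  route cannot return to vertices shared with such a route once it has met a route towards its own
  end. Cutting every route at the first such meeting point therefore separates all start parts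
  from all end parts, although routes with a common endpoint may intersect arbitrarily.
\<close>

locale routed_bipartite = graph G for G :: "('a, 'b) pre_digraph" +
  fixes L R :: "nat set" and E :: "nat \<Rightarrow> nat \<Rightarrow> bool" and w u :: "nat \<Rightarrow> 'a"
    and p :: "nat \<Rightarrow> nat \<Rightarrow> 'a list" and m :: nat
  assumes left_deg: "\<And>l r. l \<in> L \<Longrightarrow> \<exists>r' \<in> R. r' \<noteq> r \<and> E l r'"
    and right_deg: "\<And>l r. r \<in> R \<Longrightarrow> \<exists>l' \<in> L. l' \<noteq> l \<and> E l' r"
    and route: "\<And>l r. l \<in> L \<Longrightarrow> r \<in> R \<Longrightarrow> E l r \<Longrightarrow>
      vpath (p l r) G \<and> hd (p l r) = w l \<and> last (p l r) = u r \<and> length (p l r) \<le> m"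
    and indep: "\<And>l r l' r'. l \<in> L \<Longrightarrow> l' \<in> L \<Longrightarrow> r \<in> R \<Longrightarrow> r' \<in> R \<Longrightarrow> E l r \<Longrightarrow> E l' r' \<Longrightarrow>
      l \<noteq> l' \<Longrightarrow> r \<noteq> r' \<Longrightarrow> set (p l r) \<inter> set (p l' r') = {}"
    and tree: "\<And>l r r' a y b. l \<in> L \<Longrightarrow> r \<in> R \<Longrightarrow> r' \<in> R \<Longrightarrow> E l r \<Longrightarrow> E l r' \<Longrightarrow>
      p l r = a @ y # b \<Longrightarrow> y \<in> set (p l r') \<Longrightarrow> set a \<subseteq> set (p l r')"
begin

definition meets :: "nat \<Rightarrow> nat \<Rightarrow> 'a \<Rightarrow> bool" where
  "meets l r v \<longleftrightarrow> (\<exists>l' \<in> L. l' \<noteq> l \<and> E l' r \<and> v \<in> set (p l' r))"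

definition start_part :: "nat \<Rightarrow> nat \<Rightarrow> 'a list" where
  "start_part l r = takeWhile (\<lambda>v. \<not> meets l r v) (p l r)"

definition end_part :: "nat \<Rightarrow> nat \<Rightarrow> 'a list" where
  "end_part l r = dropWhile (\<lambda>v. \<not> meets l r v) (p l r)"

definition start_set :: "nat \<Rightarrow> 'a set" where
  "start_set l = (\<Union>r \<in> {r \<in> R. E l r}. set (start_part l r))"

definition end_set :: "nat \<Rightarrow> 'a set" where
  "end_set r = (\<Union>l \<in> {l \<in> L. E l r}. set (end_part l r))"

context
  fixes l r assumes lr: "l \<in> L" "r \<in> R" "E l r"
begin

lemma parts: "p l r = start_part l r @ end_part l r"
  by (simp add: start_part_def end_part_def)

lemma p_ne: "p l r \<noteq> []"
  using route[OF lr] by (auto simp: vpath_def vwalk_def)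

lemma not_meets_start: "v \<in> set (start_part l r) \<Longrightarrow> \<not> meets l r v"
  by (auto simp: start_part_def dest: set_takeWhileD)

lemma start_part: "start_part l r \<noteq> []" "hd (start_part l r) = w l" "w l \<in> set (start_part l r)"
proof -
  have "\<not> meets l r (w l)"
  proof
    assume "meets l r (w l)"
    then obtain l' where l': "l' \<in> L" "l' \<noteq> l" "E l' r" "w l \<in> set (p l' r)" by (auto simp: meets_def)
    obtain r' where r': "r' \<in> R" "r' \<noteq> r" "E l r'" using left_deg[OF lr(1)] by blast
    have "w l \<in> set (p l r')" using route[OF lr(1) r'(1,3)] hd_in_set[of "p l r'"] by (auto simp: vpath_def vwalk_def)
    with indep[of l l' r' r] l' r' lr show False by auto
  qed
  then show "start_part l r \<noteq> []" "hd (start_part l r) = w l"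
    unfolding start_part_def using p_ne route[OF lr] by (cases "p l r"; force)+
  then show "w l \<in> set (start_part l r)" by (metis list.set_sel(1))
qed

lemma end_part: "end_part l r \<noteq> []" "last (end_part l r) = u r" "u r \<in> set (end_part l r)"
  "meets l r (hd (end_part l r))"
proof -
  obtain l' where l': "l' \<in> L" "l' \<noteq> l" "E l' r" using right_deg[OF lr(2)] by blast
  have "u r \<in> set (p l' r)" using route[OF l'(1) lr(2) l'(3)] last_in_set[of "p l' r"] by (auto simp: vpath_def vwalk_def)
  with l' have "meets l r (u r)" by (auto simp: meets_def)
  moreover have "u r \<in> set (p l r)" using route[OF lr] last_in_set[OF p_ne] by simp
  ultimately show ne: "end_part l r \<noteq> []" by (auto simp: end_part_def dropWhile_eq_Nil_conv)
  then show "last (end_part l r) = u r" using route[OF lr] parts by simp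
  with ne show "u r \<in> set (end_part l r)" by (metis last_in_set)
  show "meets l r (hd (end_part l r))" using ne hd_dropWhile[of "\<lambda>v. \<not> meets l r v" "p l r"]
    by (simp add: end_part_def)
qed

lemma part_vwalks: "vwalk (start_part l r) G" "vwalk (end_part l r) G"
  "last (start_part l r) \<rightarrow>\<^bsub>G\<^esub> hd (end_part l r)"
  using route[OF lr] start_part(1) end_part(1)
  by (auto simp: parts vpath_def vwalk_def vwalk_arcs_append)

lemma end_part_avoids:
  assumes "r' \<in> R" "E l r'" "r' \<noteq> r"
  shows "set (end_part l r) \<inter> set (p l r') = {}"
proof (rule ccontr)
  assume "\<not> ?thesis"
  then obtain y where y: "y \<in> set (end_part l r)" "y \<in> set (p l r')" by auto
  let ?z = "hd (end_part l r)"
  obtain a b where ab: "end_part l r = a @ y # b" using y(1) by (meson split_list)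
  then have "set (start_part l r @ a) \<subseteq> set (p l r')"
    using tree[OF lr(1,2) assms(1) lr(3) assms(2), of "start_part l r @ a" y b] y(2) parts by simp
  moreover have "?z \<in> set a \<union> {y}" using ab by (cases a) auto
  ultimately have z: "?z \<in> set (p l r')" using y(2) by auto
  obtain l' where "l' \<in> L" "l' \<noteq> l" "E l' r" "?z \<in> set (p l' r)" using end_part(4) by (auto simp: meets_def)
  with z indep[of l l' r' r] lr assms show False by auto
qed

end

lemma start_sets_disjoint:
  assumes "l \<in> L" "l' \<in> L" "l \<noteq> l'"
  shows "start_set l \<inter> start_set l' = {}"
proof (rule ccontr)
  assume "\<not> ?thesis"
  then obtain y r r' where y: "r \<in> R" "E l r" "y \<in> set (start_part l r)"
    "r' \<in> R" "E l' r'" "y \<in> set (start_part l' r')" by (auto simp: start_set_def)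
  then have p: "y \<in> set (p l r)" "y \<in> set (p l' r')" using parts assms by auto
  show False
  proof (cases "r = r'")
    case True
    then have "meets l r y" using p(2) y assms by (auto simp: meets_def)
    with not_meets_start y assms show False by blast
  next
    case False
    with indep[of l l' r r'] p y assms show False by auto
  qed
qed

lemma end_sets_disjoint:
  assumes "r \<in> R" "r' \<in> R" "r \<noteq> r'"
  shows "end_set r \<inter> end_set r' = {}"
proof (rule ccontr)
  assume "\<not> ?thesis"
  then obtain y l l' where y: "l \<in> L" "E l r" "y \<in> set (end_part l r)"
    "l' \<in> L" "E l' r'" "y \<in> set (end_part l' r')" by (auto simp: end_set_def)
  then have p: "y \<in> set (p l r)" "y \<in> set (p l' r')" using parts assms by auto
  show False
  proof (cases "l = l'")
    case True
    with end_part_avoids[of l r r'] p y assms show False by auto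
  next
    case False
    with indep[of l l' r r'] p y assms show False by auto
  qed
qed

lemma start_set_end_set_disjoint:
  assumes "l \<in> L" "r \<in> R"
  shows "start_set l \<inter> end_set r = {}"
proof (rule ccontr)
  assume "\<not> ?thesis"
  then obtain y l' r' where y: "r' \<in> R" "E l r'" "y \<in> set (start_part l r')"
    "l' \<in> L" "E l' r" "y \<in> set (end_part l' r)" by (auto simp: start_set_def end_set_def)
  then have p: "y \<in> set (p l r')" "y \<in> set (p l' r)" using parts assms by auto
  show False
  proof (cases "l = l'")
    case True
    show False
    proof (cases "r = r'")
      case True
      with \<open>l = l'\<close> y assms have "distinct (start_part l r @ end_part l r)"
        using route[of l r] parts[of l r] by (auto simp: vpath_def)
      with True \<open>l = l'\<close> y show False by auto
    next
      case False
      with \<open>l = l'\<close> end_part_avoids[of l r r'] p y assms show False by auto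
    qed
  next
    case False
    show False
    proof (cases "r = r'")
      case True
      then have "meets l r y" using p(2) y False by (auto simp: meets_def)
      with not_meets_start True y assms show False by blast
    next
      case neq: False
      with indep[of l l' r' r] p y assms False show False by auto
    qed
  qed
qed

lemma vwalk_start_set:
  assumes "l \<in> L" "x \<in> start_set l"
  obtains q where "vwalk q G" "hd q = w l" "last q = x" "set q \<subseteq> start_set l"
proof -
  obtain r where r: "r \<in> R" "E l r" "x \<in> set (start_part l r)" using assms(2) by (auto simp: start_set_def)
  obtain q where "vwalk q G" "hd q = w l" "last q = x" "set q \<subseteq> set (start_part l r)"
    using vwalk_prefix[OF part_vwalks(1)[OF assms(1) r(1,2)] r(3)] start_part(2)[OF assms(1) r(1,2)] by metis
  then show ?thesis using that[of q] r by (auto simp: start_set_def)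
qed

lemma vwalk_end_set:
  assumes "r \<in> R" "x \<in> end_set r"
  obtains q where "vwalk q G" "hd q = u r" "last q = x" "set q \<subseteq> end_set r"
proof -
  obtain l where l: "l \<in> L" "E l r" "x \<in> set (end_part l r)" using assms(2) by (auto simp: end_set_def)
  note lr = l(1) assms(1) l(2)
  have "vwalk (rev (end_part l r)) G" using vwalk_rev_ex[OF sym_arcs part_vwalks(2)[OF lr]] .
  moreover have "hd (rev (end_part l r)) = u r" using end_part(2)[OF lr] by (simp add: hd_rev)
  ultimately obtain q where "vwalk q G" "hd q = u r" "last q = x" "set q \<subseteq> set (end_part l r)"
    using vwalk_prefix[of "rev (end_part l r)" G x] l(3) by (metis set_rev)
  then show ?thesis using that[of q] l by (auto simp: end_set_def)
qed

lemma vwalk_start_to_end: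
  assumes lr: "l \<in> L" "r \<in> R" "E l r"
  shows "vwalk (p l r) G" "hd (p l r) = w l" "last (p l r) = u r"
    "set (p l r) \<subseteq> start_set l \<union> end_set r"
  using route[OF lr] parts[OF lr] lr by (auto simp: vpath_def start_set_def end_set_def)

lemma near_start_set:
  assumes "l \<in> L" "x \<in> start_set l"
  shows "near m x (w l)" "near m (w l) x"
proof -
  obtain r where r: "r \<in> R" "E l r" "x \<in> set (start_part l r)" using assms(2) by (auto simp: start_set_def)
  then have "x \<in> set (p l r)" using parts assms(1) by auto
  with near_on_vwalk(1,2)[of "p l r" x] route[OF assms(1) r(1,2)]
  show "near m x (w l)" "near m (w l) x" by (auto simp: vpath_def intro: near_mono)
qed

lemma near_end_set:
  assumes "r \<in> R" "x \<in> end_set r"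
  shows "near m x (u r)" "near m (u r) x"
proof -
  obtain l where l: "l \<in> L" "E l r" "x \<in> set (end_part l r)" using assms(2) by (auto simp: end_set_def)
  then have "x \<in> set (p l r)" using parts assms(1) by auto
  with near_on_vwalk(3,4)[of "p l r" x] route[OF l(1) assms(1) l(2)]
  show "near m x (u r)" "near m (u r) x" by (auto simp: vpath_def intro: near_mono)
qed

lemma near_start_end:
  assumes "l \<in> L" "r \<in> R" "E l r"
  shows "near m (w l) (u r)" "near m (u r) (w l)"
  using near_on_vwalk(1,2)[of "p l r" "u r"] route[OF assms] last_in_set[of "p l r"] p_ne[OF assms]
  by (auto simp: vpath_def intro: near_mono)

definition branch_set :: "nat set \<Rightarrow> nat set \<Rightarrow> 'a set" where
  "branch_set X Y = (\<Union>l\<in>X. start_set l) \<union> (\<Union>r\<in>Y. end_set r)"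

text \<open>The index sets of a branch set form a double star with centres \<open>c\<close> and \<open>d\<close>, of radius two from \<open>d\<close>.\<close>

context
  fixes X Y c d
  assumes X: "X \<subseteq> L" and Y: "Y \<subseteq> R" and c: "c \<in> X" and d: "d \<in> Y"
    and Xd: "\<And>x. x \<in> X \<Longrightarrow> E x d" and cY: "\<And>y. y \<in> Y \<Longrightarrow> E c y"
begin

lemma branch_set_near:
  assumes "x \<in> branch_set X Y"
  shows "near (3 * m) x (u d)" "near (3 * m) (u d) x"
proof -
  have "near (3 * m) x (u d) \<and> near (3 * m) (u d) x"
  proof (cases "\<exists>l\<in>X. x \<in> start_set l")
    case True
    then obtain l where l: "l \<in> X" "x \<in> start_set l" by auto
    then have "near m x (w l)" "near m (w l) x" "near m (w l) (u d)" "near m (u d) (w l)"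
      using near_start_set[of l x] near_start_end[of l d] X Y d Xd by auto
    then have "near (m + m) x (u d)" "near (m + m) (u d) x" by (blast intro: near_trans)+
    then show ?thesis by (auto intro: near_mono)
  next
    case False
    then obtain r where r: "r \<in> Y" "x \<in> end_set r" using assms by (auto simp: branch_set_def)
    then have "near m x (u r)" "near m (u r) x" "near m (u r) (w c)" "near m (w c) (u r)"
      "near m (w c) (u d)" "near m (u d) (w c)"
      using near_end_set[of r x] near_start_end[of c r] near_start_end[of c d] X Y c d Xd cY by auto
    then have "near (m + m + m) x (u d)" "near (m + (m + m)) (u d) x" by (blast intro: near_trans)+
    then show ?thesis by (auto intro: near_mono)
  qed
  then show "near (3 * m) x (u d)" "near (3 * m) (u d) x" by auto
qed

lemma branch_set_dist:
  assumes "x \<in> branch_set X Y" "y \<in> branch_set X Y"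
  shows "dist_in G x y \<le> ereal (real (6 * m))"
  using near_imp_dist_le[OF near_trans[OF branch_set_near(1)[OF assms(1)] branch_set_near(2)[OF assms(2)]]]
  by simp

lemma branch_set_verts: "branch_set X Y \<subseteq> verts G"
proof -
  have "start_set l \<subseteq> verts G" if "l \<in> L" for l
    using part_vwalks(1)[OF that] by (force simp: start_set_def vwalk_def)
  moreover have "end_set r \<subseteq> verts G" if "r \<in> R" for r
    using part_vwalks(2)[OF _ that] by (force simp: end_set_def vwalk_def)
  ultimately show ?thesis using X Y unfolding branch_set_def by blast
qed

lemma branch_set_connected: "Digraph_Component.connected (G \<restriction> branch_set X Y)"
proof (rule connected_induce_subgraphI[OF branch_set_verts])
  interpret D: wf_digraph "G \<restriction> branch_set X Y" by auto
  let ?D = "G \<restriction> branch_set X Y"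
  have walkI: "a \<rightarrow>\<^sup>*\<^bsub>?D\<^esub> b" if "vwalk q G" "hd q = a" "last q = b" "set q \<subseteq> branch_set X Y" for q a b
  proof -
    have "vwalk q ?D" using that(1,4) unfolding vwalk_induce_subgraph by (simp add: vwalk_def)
    then show ?thesis using that(2,3) D.reachable_vwalk_conv by blast
  qed
  have start: "start_set l \<subseteq> branch_set X Y" if "l \<in> X" for l using that by (auto simp: branch_set_def)
  have fin: "end_set r \<subseteq> branch_set X Y" if "r \<in> Y" for r using that by (auto simp: branch_set_def)
  have sym: "symmetric ?D"
    using induced_graph_imp_symmetric[OF sym_arcs induced_induce[OF branch_set_verts]] .
  have cross: "w l \<rightarrow>\<^sup>*\<^bsub>?D\<^esub> u r" if "l \<in> X" "r \<in> Y" "E l r" for l r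
  proof -
    have lr: "l \<in> L" "r \<in> R" "E l r" using that X Y by blast+
    have "set (p l r) \<subseteq> branch_set X Y"
      using vwalk_start_to_end(4)[OF lr] start[OF that(1)] fin[OF that(2)] by blast
    with vwalk_start_to_end(1-3)[OF lr] show ?thesis by (rule walkI)
  qed
  have "u d \<rightarrow>\<^sup>*\<^bsub>?D\<^esub> x" if x: "x \<in> branch_set X Y" for x
  proof (cases "\<exists>l\<in>X. x \<in> start_set l")
    case True
    then obtain l where l: "l \<in> X" "x \<in> start_set l" by auto
    obtain q where "vwalk q G" "hd q = w l" "last q = x" "set q \<subseteq> start_set l"
      using vwalk_start_set[OF _ l(2)] l(1) X by auto
    then have "w l \<rightarrow>\<^sup>*\<^bsub>?D\<^esub> x" using start[OF l(1)] by (intro walkI) auto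
    moreover have "u d \<rightarrow>\<^sup>*\<^bsub>?D\<^esub> w l" using symmetric_reachable[OF sym cross[OF l(1) d Xd[OF l(1)]]] .
    ultimately show ?thesis by (rule D.reachable_trans[rotated])
  next
    case False
    then obtain r where r: "r \<in> Y" "x \<in> end_set r" using x by (auto simp: branch_set_def)
    obtain q where "vwalk q G" "hd q = u r" "last q = x" "set q \<subseteq> end_set r"
      using vwalk_end_set[OF _ r(2)] r(1) Y by auto
    then have "u r \<rightarrow>\<^sup>*\<^bsub>?D\<^esub> x" using fin[OF r(1)] by (intro walkI) auto
    moreover have "u d \<rightarrow>\<^sup>*\<^bsub>?D\<^esub> w c" using symmetric_reachable[OF sym cross[OF c d Xd[OF c]]] .
    moreover have "w c \<rightarrow>\<^sup>*\<^bsub>?D\<^esub> u r" using cross[OF c r(1) cY[OF r(1)]] .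
    ultimately show ?thesis using D.reachable_trans by blast
  qed
  then show "\<exists>q. vwalk q ?D \<and> hd q = u d \<and> last q = x" if "x \<in> branch_set X Y" for x
    using that by (simp add: D.reachable_vwalk_conv)
  show "u d \<in> branch_set X Y"
  proof -
    have cd: "c \<in> L" "d \<in> R" "E c d" using c d X Y Xd by blast+
    from end_part(3)[OF this] cd d show ?thesis by (auto simp: branch_set_def end_set_def)
  qed
qed

end

lemma branch_sets_disjoint:
  assumes "X \<subseteq> L" "Y \<subseteq> R" "X' \<subseteq> L" "Y' \<subseteq> R" "X \<inter> X' = {}" "Y \<inter> Y' = {}"
  shows "branch_set X Y \<inter> branch_set X' Y' = {}"
proof -
  have "start_set l \<inter> start_set l' = {}" if "l \<in> X" "l' \<in> X'" for l l'
    using start_sets_disjoint[of l l'] assms that by blast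
  moreover have "end_set r \<inter> end_set r' = {}" if "r \<in> Y" "r' \<in> Y'" for r r'
    using end_sets_disjoint[of r r'] assms that by blast
  moreover have "start_set l \<inter> end_set r = {}" if "l \<in> L" "r \<in> R" for l r
    using start_set_end_set_disjoint that by blast
  ultimately show ?thesis using assms unfolding branch_set_def by blast
qed

lemma branch_sets_adjacent:
  assumes "X' \<subseteq> L" "Y \<subseteq> R" "x \<in> X'" "y \<in> Y" "E x y"
  shows "\<exists>a \<in> branch_set X Y. \<exists>b \<in> branch_set X' Y'. a \<rightarrow>\<^bsub>G\<^esub> b"
proof -
  have xy: "x \<in> L" "y \<in> R" "E x y" using assms by auto
  have "hd (end_part x y) \<in> end_set y" "last (start_part x y) \<in> start_set x"
    using xy start_part(1)[OF xy] end_part(1)[OF xy] by (auto simp: start_set_def end_set_def)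
  moreover have "hd (end_part x y) \<rightarrow>\<^bsub>G\<^esub> last (start_part x y)"
    using part_vwalks(3)[OF xy] arcs_ends_symmetric[OF sym_arcs] by blast
  ultimately show ?thesis using assms(3,4) by (auto simp: branch_set_def)
qed

lemma complete_minor:
  assumes stars: "\<And>i. i < h \<Longrightarrow> X i \<subseteq> L \<and> Y i \<subseteq> R \<and> c i \<in> X i \<and> d i \<in> Y i"
    "\<And>i x. i < h \<Longrightarrow> x \<in> X i \<Longrightarrow> E x (d i)" "\<And>i y. i < h \<Longrightarrow> y \<in> Y i \<Longrightarrow> E (c i) y"
    and pairs: "\<And>i j. i < j \<Longrightarrow> j < h \<Longrightarrow>
      X i \<inter> X j = {} \<and> Y i \<inter> Y j = {} \<and> (\<exists>x \<in> X j. \<exists>y \<in> Y i. E x y)"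
    and depth: "6 * m \<le> depth"
  shows "\<not> excludes_complete_minor h depth G"
proof (rule complete_minorI[of h "\<lambda>i. branch_set (X i) (Y i)"])
  fix i assume i: "i < h"
  note star = stars(1)[OF i] stars(2)[OF i] stars(3)[OF i]
  show "branch_set (X i) (Y i) \<subseteq> verts G"
    by (rule branch_set_verts[of _ _ "c i" "d i"]) (use star in auto)
  show "Digraph_Component.connected (G \<restriction> branch_set (X i) (Y i))"
    by (rule branch_set_connected[of _ _ "c i" "d i"]) (use star in auto)
  fix x y assume "x \<in> branch_set (X i) (Y i)" "y \<in> branch_set (X i) (Y i)"
  then have "dist_in G x y \<le> ereal (real (6 * m))"
    by (intro branch_set_dist[of "X i" "Y i" "c i" "d i"]) (use star in auto)
  also have "\<dots> \<le> ereal (real depth)" using depth by (simp del: of_nat_mult)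
  finally show "dist_in G x y \<le> ereal (real depth)" .
next
  fix i j assume ij: "i < j" "j < h"
  then have "X i \<subseteq> L" "Y i \<subseteq> R" "X j \<subseteq> L" "Y j \<subseteq> R" using stars(1)[of i] stars(1)[of j] by auto
  moreover obtain x y where "x \<in> X j" "y \<in> Y i" "E x y" using pairs[OF ij] by blast
  ultimately show "branch_set (X i) (Y i) \<inter> branch_set (X j) (Y j) = {}"
    "\<exists>x\<in>branch_set (X i) (Y i). \<exists>y\<in>branch_set (X j) (Y j). x \<rightarrow>\<^bsub>G\<^esub> y"
    using pairs[OF ij] branch_sets_disjoint branch_sets_adjacent by simp_all
qed

end

section \<open>The lower bound\<close>

lemma sum_swap4:
  "(\<Sum>a\<in>A. \<Sum>b\<in>B. \<Sum>c\<in>C. \<Sum>d\<in>D. \<Sum>v\<in>W. f a b c d v) = (\<Sum>v\<in>W. \<Sum>a\<in>A. \<Sum>b\<in>B. \<Sum>c\<in>C. \<Sum>d\<in>D. f a b c d v)"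
  by (simp only: sum.swap[of _ A W] sum.swap[of _ B W] sum.swap[of _ C W] sum.swap[of _ D W])

lemma path_tree_shared_prefix:
  assumes t: "path_tree G x t" and y: "y \<in> verts G" "y' \<in> verts G"
    and split: "t y = a @ z # b" and z: "z \<in> set (t y')"
  shows "set a \<subseteq> set (t y')"
proof -
  have "z \<in> verts G" using t y(1) split by (auto simp: path_tree_def vpath_def vwalk_def)
  then have tz: "t z \<noteq> []" "last (t z) = z" using t by (auto simp: path_tree_def vpath_def vwalk_def)
  define a' where "a' = butlast (t z)"
  have a': "t z = a' @ [z]" using tz by (metis a'_def append_butlast_last_id)
  obtain q where q: "t y = t z @ q" using t y(1) split by (fastforce simp: path_tree_def)
  have "distinct (t y)" using t y(1) by (auto simp: path_tree_def vpath_def)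
  moreover have "a @ z # b = a' @ z # q" using q split a' by simp
  ultimately have "a = a'" using split by (subst (asm) append_Cons_eq_iff) auto
  moreover have "set (t z) \<subseteq> set (t y')" using t y(2) z by (fastforce simp: path_tree_def)
  ultimately show ?thesis using a' by auto
qed

lemma sample_size_bounds:
  fixes h s :: nat
  assumes "2 \<le> h" and s: "s = nat \<lceil>sqrt (ln (real h))\<rceil>"
  shows "1 \<le> s" "h < 4 ^ (s * s)" "real (16 * (h * (s + 1))) \<le> 64 * (real h * sqrt (ln (real h)))"
proof -
  define r where "r = sqrt (ln (real h))"
  have "2 / 3 \<le> ln (2 :: real)" by (rule ln2_ge_two_thirds)
  also have "\<dots> \<le> ln (real h)" using assms by simp
  finally have ln: "2 / 3 \<le> ln (real h)" .
  have "(2 / 3)\<^sup>2 \<le> ln (real h)" using ln by (simp add: power2_eq_square)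
  then have r: "2 / 3 \<le> r" unfolding r_def by (rule real_le_rsqrt)
  have s_bounds: "r \<le> s" "s \<le> r + 1" using r unfolding s r_def[symmetric] by linarith+
  then have "0 < s" using r by linarith
  then show "1 \<le> s" by simp
  have "real h = exp (ln (real h))" using assms by simp
  also have "ln (real h) = r ^ 2" unfolding r_def using ln by simp
  also have "exp (r ^ 2) \<le> exp (real (s * s))"
    using s_bounds r by (simp add: power2_eq_square mult_mono)
  also have "\<dots> = exp 1 ^ (s * s)" by (simp flip: exp_of_nat_mult)
  also have "\<dots> \<le> 3 ^ (s * s)" using exp_le by (intro power_mono) auto
  also have "\<dots> < 4 ^ (s * s)" using \<open>0 < s\<close> by (intro power_strict_mono) auto
  finally have "real h < real (4 ^ (s * s))" by simp
  then show "h < 4 ^ (s * s)" by (simp only: of_nat_less_iff)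
  have "real (16 * (h * (s + 1))) = 16 * real h * (s + 1)" by (simp add: algebra_simps)
  also have "\<dots> \<le> 16 * real h * (4 * r)" using s_bounds r by (intro mult_left_mono) auto
  finally show "real (16 * (h * (s + 1))) \<le> 64 * (real h * sqrt (ln (real h)))" by (simp add: r_def)
qed

context complete_flow
begin

lemma not_excludes_complete_minor:
  assumes h: "2 \<le> h" and depth: "1 \<le> depth"
    and flow_lt: "12288 * con2 G F < real (card V) ^ 2 / (real h * sqrt (ln (real h)))"
    and depth_gt: "12288 * con2 G F < real (card V) powr (3 / 2) * real depth"
  shows "\<not> excludes_complete_minor h depth G"
proof -
  define n where "n = real (card V)"
  define S where "S = real h * sqrt (ln (real h))"
  define s where "s = nat \<lceil>sqrt (ln (real h))\<rceil>"
  define k where "k = 16 * (h * (s + 1))"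
  note size = sample_size_bounds[OF h s_def]
  have npos: "n > 0" using two_verts by (simp add: n_def)
  have con2_nonneg: "0 \<le> con2 G F" by (simp add: con2_def sum_nonneg)
  have Spos: "S > 0" using h by (simp add: S_def)
  obtain T where T: "\<And>w. w \<in> V \<Longrightarrow> path_tree G w (T w)"
    and light: "(\<Sum>v\<in>V. (\<Sum>w\<in>V. real (load G (T w) v))\<^sup>2) \<le> 54 * (con2 G F)\<^sup>2"
    using exists_light_path_trees by blast
  define Y where "Y v = (\<Sum>w\<in>V. real (load G (T w) v))" for v
  have Ysq: "(\<Sum>v\<in>V. (Y v)\<^sup>2) \<le> (8 * con2 G F)\<^sup>2"
    by (rule order_trans[OF light[folded Y_def]]) (simp add: power_mult_distrib mult_right_mono)
  have T_path: "vpath (T x y) G" "hd (T x y) = x" "last (T x y) = y" if "x \<in> V" "y \<in> V" for x y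
    using T that by (auto simp: path_tree_def)
  have T_sub: "set (T x y) \<subseteq> V" "distinct (T x y)" if "x \<in> V" "y \<in> V" for x y
    using T_path(1)[OF that] by (auto simp: vpath_def vwalk_def)
  have Y_eq: "Y v = (\<Sum>x\<in>V. \<Sum>y\<in>V. of_bool (v \<in> set (T x y)))" for v
    by (simp add: Y_def load_def Int_def)
  define long where "long x y \<longleftrightarrow> depth < 6 * length (T x y)" for x y
  define cross where "cross x y x' y' \<longleftrightarrow> set (T x y) \<inter> set (T x' y') \<noteq> {}" for x y x' y'
  have long_le: "real (card {(x, y) \<in> V \<times> V. long x y}) \<le> 1 / 256 * real (card V) ^ 2"
  proof -
    have "(\<Sum>v\<in>V. Y v)\<^sup>2 \<le> (\<Sum>v\<in>V. (Y v)\<^sup>2) * n"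
      unfolding n_def by (rule sum_squared_le_sum_of_squares)
    also have "\<dots> \<le> (8 * con2 G F)\<^sup>2 * n" using Ysq npos by (intro mult_right_mono) auto
    also have "\<dots> \<le> (n powr (3 / 2) * real depth / 1536)\<^sup>2 * n"
      using depth_gt con2_nonneg npos by (intro mult_right_mono power_mono) (auto simp: n_def)
    also have "\<dots> = (n powr (3 / 2))\<^sup>2 * n * (real depth / 1536)\<^sup>2"
      by (simp add: power_mult_distrib power_divide)
    also have "(n powr (3 / 2))\<^sup>2 = n ^ 3"
    proof -
      have "(n powr (3 / 2))\<^sup>2 = n powr (3 / 2 + 3 / 2)" by (simp only: power2_eq_square powr_add)
      also have "3 / 2 + 3 / 2 = real 3" by simp
      finally show ?thesis using powr_realpow[OF npos, of 3] by simp
    qed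
    also have "n ^ 3 * n * (real depth / 1536)\<^sup>2 = (n ^ 2 * real depth / 1536)\<^sup>2"
      by (simp add: power_mult_distrib power_divide power2_eq_square power3_eq_cube)
    finally have sumY: "(\<Sum>v\<in>V. Y v) \<le> n ^ 2 * real depth / 1536"
      by (rule power2_le_imp_le) (use npos in auto)
    have "real depth * card {(x, y) \<in> V \<times> V. long x y} = (\<Sum>(x, y) | (x, y) \<in> V \<times> V \<and> long x y. real depth)"
      by (simp add: case_prod_unfold)
    also have "\<dots> \<le> (\<Sum>(x, y) | (x, y) \<in> V \<times> V \<and> long x y. 6 * real (length (T x y)))"
      by (intro sum_mono) (auto simp: long_def)
    also have "\<dots> \<le> (\<Sum>(x, y)\<in>V \<times> V. 6 * real (length (T x y)))"
      by (intro sum_mono2) auto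
    also have "\<dots> = 6 * (\<Sum>x\<in>V. \<Sum>y\<in>V. \<Sum>v\<in>V. of_bool (v \<in> set (T x y)))"
    proof -
      have "real (length (T x y)) = (\<Sum>v\<in>V. of_bool (v \<in> set (T x y)))" if "x \<in> V" "y \<in> V" for x y
        using T_sub[OF that] by (simp add: distinct_card Int_absorb1)
      then show ?thesis by (simp flip: sum.cartesian_product sum_distrib_left)
    qed
    also have "(\<Sum>x\<in>V. \<Sum>y\<in>V. \<Sum>v\<in>V. of_bool (v \<in> set (T x y))) = (\<Sum>v\<in>V. Y v)"
    proof -
      have "(\<Sum>x\<in>A. \<Sum>y\<in>B. \<Sum>v\<in>W. f x y v) = (\<Sum>v\<in>W. \<Sum>x\<in>A. \<Sum>y\<in>B. f x y v)"
        for A B W and f :: "'a \<Rightarrow> 'a \<Rightarrow> 'a \<Rightarrow> real"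
        by (simp only: sum.swap[of _ A W] sum.swap[of _ B W])
      then show ?thesis unfolding Y_eq .
    qed
    also have "6 * (\<Sum>v\<in>V. Y v) \<le> real depth * (n ^ 2 / 256)" using sumY by (simp add: mult.commute)
    finally show ?thesis using depth by (simp add: n_def)
  qed
  have cross_le: "(\<Sum>x\<in>V. \<Sum>x'\<in>V. \<Sum>y\<in>V. \<Sum>y'\<in>V. of_bool (cross x y x' y'))
      \<le> (1 / (1536 * S))\<^sup>2 * real (card V) ^ 4"
  proof -
    have "(\<Sum>x\<in>V. \<Sum>x'\<in>V. \<Sum>y\<in>V. \<Sum>y'\<in>V. of_bool (cross x y x' y') :: real)
        \<le> (\<Sum>x\<in>V. \<Sum>x'\<in>V. \<Sum>y\<in>V. \<Sum>y'\<in>V. \<Sum>v\<in>V. of_bool (v \<in> set (T x y)) * of_bool (v \<in> set (T x' y')))"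
    proof (intro sum_mono)
      fix x x' y y' assume V: "x \<in> V" "x' \<in> V" "y \<in> V" "y' \<in> V"
      show "of_bool (cross x y x' y') \<le> (\<Sum>v\<in>V. of_bool (v \<in> set (T x y)) * of_bool (v \<in> set (T x' y')) :: real)"
      proof (cases "cross x y x' y'")
        case True
        then obtain v where v: "v \<in> set (T x y)" "v \<in> set (T x' y')" by (auto simp: cross_def)
        then have "v \<in> V" using T_sub V by auto
        then have "of_bool (v \<in> set (T x y)) * of_bool (v \<in> set (T x' y'))
            \<le> (\<Sum>v\<in>V. of_bool (v \<in> set (T x y)) * of_bool (v \<in> set (T x' y')) :: real)"
          by (intro member_le_sum) auto
        with v show ?thesis by simp
      qed (auto intro: sum_nonneg)
    qed
    also have "\<dots> = (\<Sum>v\<in>V. \<Sum>x\<in>V. \<Sum>x'\<in>V. \<Sum>y\<in>V. \<Sum>y'\<in>V. of_bool (v \<in> set (T x y)) * of_bool (v \<in> set (T x' y')))"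
      by (rule sum_swap4)
    also have "\<dots> = (\<Sum>v\<in>V. (Y v)\<^sup>2)"
      by (simp add: Y_eq power2_eq_square sum_product del: sum_of_bool_eq sum_of_bool_mult_eq sum_mult_of_bool_eq)
    also note Ysq
    also have "(8 * con2 G F)\<^sup>2 \<le> (n ^ 2 / (1536 * S))\<^sup>2"
      using flow_lt con2_nonneg Spos by (intro power_mono) (auto simp: n_def S_def field_simps)
    also have "\<dots> = (1 / (1536 * S))\<^sup>2 * n ^ 4" by (simp add: power_divide flip: power_mult)
    finally show ?thesis by (simp add: n_def)
  qed
  obtain w u where w: "w \<in> {..<k} \<rightarrow> V" and u: "u \<in> {..<k} \<rightarrow> V"
    and bad: "real (card {(l, r) \<in> {..<k} \<times> {..<k}. long (w l) (u r) \<or>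
       (\<exists>l'<k. \<exists>r'<k. l \<noteq> l' \<and> r \<noteq> r' \<and> cross (w l) (u r) (w l') (u r'))})
     \<le> 1 / 256 * real k ^ 2 + (1 / (1536 * S))\<^sup>2 * real k ^ 4"
  proof (rule exists_sample[OF finite_verts _ long_le cross_le, where k = k])
    show "V \<noteq> {}" using two_verts by auto
  qed (rule that)
  define E where "E l r \<longleftrightarrow> \<not> (long (w l) (u r) \<or>
       (\<exists>l'<k. \<exists>r'<k. l \<noteq> l' \<and> r \<noteq> r' \<and> cross (w l) (u r) (w l') (u r')))" for l r
  have "(1 / (1536 * S))\<^sup>2 * real k ^ 4 = (real k / (1536 * S))\<^sup>2 * real k ^ 2"
    by (simp add: power_divide power2_eq_square power4_eq_xxxx)
  also have "\<dots> \<le> (1 / 24)\<^sup>2 * real k ^ 2"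
    using size(3) Spos by (intro mult_right_mono power_mono) (auto simp: k_def S_def field_simps)
  also have "\<dots> \<le> 1 / 256 * real k ^ 2" by (intro mult_right_mono) (auto simp: power2_eq_square)
  finally have "real (card {(l, r) \<in> {..<k} \<times> {..<k}. \<not> E l r}) \<le> real k ^ 2 / 128"
    using bad unfolding E_def not_not by linarith
  then have "real (128 * card {(l, r) \<in> {..<k} \<times> {..<k}. \<not> E l r}) \<le> real (k * k)"
    by (simp add: power2_eq_square)
  then have missing: "128 * card {(l, r) \<in> {..<k} \<times> {..<k}. \<not> E l r} \<le> k * k"
    by (simp only: of_nat_le_iff)
  obtain L R X Y c d where LR: "L \<subseteq> {..<k}" "R \<subseteq> {..<k}"
    and deg: "\<And>l r. l \<in> L \<Longrightarrow> \<exists>r' \<in> R. r' \<noteq> r \<and> E l r'" "\<And>l r. r \<in> R \<Longrightarrow> \<exists>l' \<in> L. l' \<noteq> l \<and> E l' r"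
    and stars: "\<And>i. i < h \<Longrightarrow> X i \<subseteq> L \<and> Y i \<subseteq> R \<and> c i \<in> X i \<and> d i \<in> Y i"
      "\<And>i x. i < h \<Longrightarrow> x \<in> X i \<Longrightarrow> E x (d i)" "\<And>i y. i < h \<Longrightarrow> y \<in> Y i \<Longrightarrow> E (c i) y"
    and pairs: "\<And>i j. i < j \<Longrightarrow> j < h \<Longrightarrow>
      X i \<inter> X j = {} \<and> Y i \<inter> Y j = {} \<and> (\<exists>x \<in> X j. \<exists>y \<in> Y i. E x y)"
  proof (rule dense_bipartite_branch_sets[OF _ size(2,1) k_def missing])
    show "1 \<le> h" using h by simp
  qed (rule that)
  have wV: "w l \<in> V" if "l \<in> L" for l using w LR(1) that by auto
  have uV: "u r \<in> V" if "r \<in> R" for r using u LR(2) that by auto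
  interpret routed_bipartite G L R E w u "\<lambda>l r. T (w l) (u r)" "depth div 6"
  proof
    fix l r assume lr: "l \<in> L" "r \<in> R" "E l r"
    have "6 * length (T (w l) (u r)) \<le> depth" using lr(3) by (auto simp: E_def long_def)
    then have "length (T (w l) (u r)) \<le> depth div 6" by linarith
    then show "vpath (T (w l) (u r)) G \<and> hd (T (w l) (u r)) = w l \<and> last (T (w l) (u r)) = u r \<and>
        length (T (w l) (u r)) \<le> depth div 6"
      using T_path[OF wV[OF lr(1)] uV[OF lr(2)]] by blast
  next
    fix l r l' r' assume "l' \<in> L" "r' \<in> R" "E l r" "l \<noteq> l'" "r \<noteq> r'"
    moreover from this have "l' < k" "r' < k" using LR by auto
    ultimately show "set (T (w l) (u r)) \<inter> set (T (w l') (u r')) = {}"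
      unfolding E_def cross_def by blast
  next
    fix l r r' a y b assume "l \<in> L" "r \<in> R" "r' \<in> R" "T (w l) (u r) = a @ y # b" "y \<in> set (T (w l) (u r'))"
    then show "set a \<subseteq> set (T (w l) (u r'))"
      using path_tree_shared_prefix[OF T[OF wV] uV uV] by metis
  qed (fact deg)+
  show ?thesis by (rule complete_minor[OF stars pairs]) auto
qed

end

theorem theorem3p12:
  shows "\<exists>c > (0::real). \<forall>(G :: ('a, 'b) pre_digraph) (h :: nat) (L :: nat) (n :: nat) (F :: 'a list \<Rightarrow> real).
    graph G \<longrightarrow> n = card (verts G) \<longrightarrow> n \<ge> 2 \<longrightarrow>
    excludes_complete_minor h L G \<longrightarrow>
    unit_complete_flow G F \<longrightarrow>
    real n \<ge> c * (real h * sqrt (ln (real h))) \<longrightarrow>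
    con2 G F \<ge> c * min (real n ^ 2 / (real h * sqrt (ln (real h)))) (real n powr (3 / 2) * real L)"
proof (intro exI[of _ "1 / 12288"] conjI allI impI)
  fix G :: "('a, 'b) pre_digraph" and h L n :: nat and F :: "'a list \<Rightarrow> real"
  assume G: "graph G" "n = card (verts G)" "n \<ge> 2" "excludes_complete_minor h L G" "unit_complete_flow G F"
  interpret complete_flow G F by (rule complete_flow.intro) (use G in auto)
  let ?S = "real h * sqrt (ln (real h))"
  have nonneg: "0 \<le> con2 G F" by (simp add: con2_def sum_nonneg)
  show "con2 G F \<ge> 1 / 12288 * min (real n ^ 2 / ?S) (real n powr (3 / 2) * real L)"
  proof (cases "2 \<le> h \<and> 1 \<le> L")
    case True
    with not_excludes_complete_minor[of h L] G(2,4)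
    have "\<not> (12288 * con2 G F < min (real n ^ 2 / ?S) (real n powr (3 / 2) * real L))" by auto
    then show ?thesis by linarith
  next
    case False
    then have "h = 0 \<or> h = 1 \<or> L = 0" by linarith
    then have "min (real n ^ 2 / ?S) (real n powr (3 / 2) * real L) \<le> 0"
      by (elim disjE) (auto simp: min_le_iff_disj)
    then show ?thesis using nonneg by linarith
  qed
qed simp

end
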